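(* Let $N$ be a finite supernatural number (a positive integer) and let $\delta:\mathcal B(N)\to B(N)$ be a derivation in the Bunce-Deddens algebra $B(N)$. Then there exists a unique $f\in C(S^1)$ such that $$\delta=\delta_f+\tilde\delta,$$ where $\tilde\delta$ is an inner derivation, and where, under the identification of $B(N)$ with $C(S^1)\otimes M_N(\mathbb C)$, $\delta_f(F(t))=f(t)\,\frac1i\frac{d}{dt}F(t)$ for every $M_N(\mathbb C)$-valued trigonometric polynomial $F$ on $S^1$.
   Context: Let $N$ be a positive integer. On $\ell^2(\mathbb Z)$ with canonical basis $\{E_l\}_{l\in\mathbb Z}$ let $VE_l=E_{l+1}$ be the bilateral shift and for a bounded sequence $b(l)$ let $b(\mathbb L)E_l=b(l)E_l$. Let $\mathcal B_{\mathrm{diag}}(N)=\{b(\mathbb L): b(l+j)=b(l)\ \forall l,\text{ for some } j\mid N\}$. The Bunce-Deddens algebra is (up to isomorphism) $B(N)=\mathrm C^*(V,\mathcal B_{\mathrm{diag}}(N))$, and $\mathcal B(N)$ is the dense $^*$-subalgebra generated algebraically by $V,V^{-1}$ and $\mathcal B_{\mathrm{diag}}(N)$. Let $e_N(l)=1$ if $N\mid l$ and $e_N(l)=0$ otherwise, and $P_{sr}=V^se_N(\mathbb L)V^{-r}$ for $0\le s,r<N$. These are matrix units commuting with $V^N$, and sending $P_{sr}$ to the standard matrix unit $E_{sr}$ and $V^N$ to the function $e^{it}$ identifies $B(N)$ with $C(S^1)\otimes M_N(\mathbb C)=C(S^1,M_N(\mathbb C))$ and $\mathcal B(N)$ with the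 algebra of $M_N(\mathbb C)$-valued trigonometric polynomials $F(t)$ on $S^1$. A derivation in $B(N)$ is a linear map $\delta:\mathcal B(N)\to B(N)$ satisfying $\delta(ab)=\delta(a)b+a\,\delta(b)$. It is inner if there is $z\in B(N)$ with $\delta(b)=[z,b]$ for all $b\in\mathcal B(N)$. *)

theory Defs
  imports "HOL-Analysis.Analysis" "Jordan_Normal_Form.Schur_Decomposition"
begin

section \<open>The Hilbert space \<open>ell2(Z)\<close>\<close>

typedef ell2Z = "{x :: int \<Rightarrow> complex. (\<lambda>l. (cmod (x l))\<^sup>2) summable_on UNIV}"
  morphisms coord Abs_ell2Z
  by (rule exI[of _ "\<lambda>_. 0"]) simp

lemma coord_summable: "(\<lambda>l. (cmod (coord x l))\<^sup>2) summable_on UNIV"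
  using coord[of x] by simp

lemma ell2Z_eqI: "(\<And>l. coord x l = coord y l) \<Longrightarrow> x = y"
  by (metis coord_inject ext)

lemma l2_add_summable:
  fixes x y :: "int \<Rightarrow> complex"
  assumes "(\<lambda>l. (cmod (x l))\<^sup>2) summable_on UNIV" "(\<lambda>l. (cmod (y l))\<^sup>2) summable_on UNIV"
  shows "(\<lambda>l. (cmod (x l + y l))\<^sup>2) summable_on UNIV"
proof (rule summable_on_comparison_test)
  show "(\<lambda>l. 2 * (cmod (x l))\<^sup>2 + 2 * (cmod (y l))\<^sup>2) summable_on UNIV"
    by (intro summable_on_add summable_on_cmult_right assms)
  show "(cmod (x l + y l))\<^sup>2 \<le> 2 * (cmod (x l))\<^sup>2 + 2 * (cmod (y l))\<^sup>2" for l
  proof -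
    have "(cmod (x l + y l))\<^sup>2 \<le> (cmod (x l) + cmod (y l))\<^sup>2"
      by (intro power_mono norm_triangle_ineq) auto
    also have "\<dots> \<le> 2 * (cmod (x l))\<^sup>2 + 2 * (cmod (y l))\<^sup>2"
      using zero_le_power2[of "cmod (x l) - cmod (y l)"] by (simp add: power2_eq_square algebra_simps)
    finally show ?thesis .
  qed
qed auto

lemma l2_bounded_mult_summable:
  fixes x b :: "int \<Rightarrow> complex"
  assumes "(\<lambda>l. (cmod (x l))\<^sup>2) summable_on UNIV" "\<And>l. cmod (b l) \<le> C"
  shows "(\<lambda>l. (cmod (b l * x l))\<^sup>2) summable_on UNIV"
proof (rule summable_on_comparison_test)
  show "(\<lambda>l. C\<^sup>2 * (cmod (x l))\<^sup>2) summable_on UNIV"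
    by (intro summable_on_cmult_right assms)
  show "(cmod (b l * x l))\<^sup>2 \<le> C\<^sup>2 * (cmod (x l))\<^sup>2" for l
    using assms(2)[of l] by (simp add: norm_mult power_mult_distrib mult_right_mono power_mono)
qed auto

lemma l2_shift_summable:
  fixes x :: "int \<Rightarrow> complex"
  assumes "(\<lambda>l. (cmod (x l))\<^sup>2) summable_on UNIV"
  shows "(\<lambda>l. (cmod (x (l - k)))\<^sup>2) summable_on UNIV"
proof -
  have "bij (\<lambda>l::int. l - k)"
    by (rule bij_betwI[of _ _ _ "\<lambda>l. l + k"]) auto
  from summable_on_reindex_bij_betw[OF this, of "\<lambda>l. (cmod (x l))\<^sup>2"] assms show ?thesis by simp
qed

lemma l2_prod_summable:
  fixes x y :: "int \<Rightarrow> complex"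
  assumes "(\<lambda>l. (cmod (x l))\<^sup>2) summable_on UNIV" "(\<lambda>l. (cmod (y l))\<^sup>2) summable_on UNIV"
  shows "(\<lambda>l. x l * cnj (y l)) summable_on UNIV"
proof -
  have "(\<lambda>l. norm (x l * cnj (y l))) summable_on UNIV"
  proof (rule summable_on_comparison_test)
    show "(\<lambda>l. (cmod (x l))\<^sup>2 + (cmod (y l))\<^sup>2) summable_on UNIV"
      by (intro summable_on_add assms)
    show "norm (x l * cnj (y l)) \<le> (cmod (x l))\<^sup>2 + (cmod (y l))\<^sup>2" for l
      using sum_squares_bound[of "cmod (x l)" "cmod (y l)"] mult_nonneg_nonneg[of "cmod (x l)" "cmod (y l)"]
      by (simp add: norm_mult power2_eq_square del: mult_nonneg_nonneg)
  qed auto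
  then show ?thesis by (rule abs_summable_summable)
qed

instantiation ell2Z :: real_vector
begin

definition zero_ell2Z :: ell2Z where "0 = Abs_ell2Z (\<lambda>_. 0)"
definition plus_ell2Z :: "ell2Z \<Rightarrow> ell2Z \<Rightarrow> ell2Z" where
  "x + y = Abs_ell2Z (\<lambda>l. coord x l + coord y l)"
definition uminus_ell2Z :: "ell2Z \<Rightarrow> ell2Z" where
  "- x = Abs_ell2Z (\<lambda>l. - coord x l)"
definition minus_ell2Z :: "ell2Z \<Rightarrow> ell2Z \<Rightarrow> ell2Z" where
  "x - y = Abs_ell2Z (\<lambda>l. coord x l - coord y l)"
definition scaleR_ell2Z :: "real \<Rightarrow> ell2Z \<Rightarrow> ell2Z" where
  "r *\<^sub>R x = Abs_ell2Z (\<lambda>l. complex_of_real r * coord x l)"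

lemma coord_0 [simp]: "coord 0 l = 0"
  by (simp add: zero_ell2Z_def Abs_ell2Z_inverse)
lemma coord_add [simp]: "coord (x + y) l = coord x l + coord y l"
  using l2_add_summable[OF coord_summable[of x] coord_summable[of y]]
  by (simp add: plus_ell2Z_def Abs_ell2Z_inverse)
lemma coord_uminus [simp]: "coord (- x) l = - coord x l"
  using coord_summable[of x] by (simp add: uminus_ell2Z_def Abs_ell2Z_inverse)
lemma coord_diff [simp]: "coord (x - y) l = coord x l - coord y l"
  using l2_add_summable[OF coord_summable[of x] coord_summable[of "-y"]]
  by (simp add: minus_ell2Z_def Abs_ell2Z_inverse)
lemma coord_scaleR [simp]: "coord (r *\<^sub>R x) l = complex_of_real r * coord x l"
  using l2_bounded_mult_summable[OF coord_summable[of x], of "\<lambda>_. complex_of_real r" "\<bar>r\<bar>"]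
  by (simp add: scaleR_ell2Z_def Abs_ell2Z_inverse)

instance
  by standard (auto intro!: ell2Z_eqI simp: algebra_simps)

end

instantiation ell2Z :: real_inner
begin

definition inner_ell2Z :: "ell2Z \<Rightarrow> ell2Z \<Rightarrow> real" where
  "inner x y = Re (\<Sum>\<^sub>\<infinity>l. coord x l * cnj (coord y l))"
definition norm_ell2Z :: "ell2Z \<Rightarrow> real" where
  "norm x = sqrt (\<Sum>\<^sub>\<infinity>l. (cmod (coord x l))\<^sup>2)"
definition dist_ell2Z :: "ell2Z \<Rightarrow> ell2Z \<Rightarrow> real" where
  "dist x y = norm (x - y :: ell2Z)"
definition sgn_ell2Z :: "ell2Z \<Rightarrow> ell2Z" where
  "sgn x = (x :: ell2Z) /\<^sub>R norm x"
definition uniformity_ell2Z :: "(ell2Z \<times> ell2Z) filter" where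
  "uniformity = (INF e\<in>{0 <..}. principal {(x, y :: ell2Z). dist x y < e})"
definition open_ell2Z :: "ell2Z set \<Rightarrow> bool" where
  "open (U :: ell2Z set) = (\<forall>x\<in>U. \<forall>\<^sub>F (x', y) in uniformity. x' = x \<longrightarrow> y \<in> U)"

instance
proof
  fix x y z :: ell2Z and r s :: real
  note ps = l2_prod_summable[OF coord_summable coord_summable]
  show "sgn x = x /\<^sub>R norm x" "dist x y = norm (x - y)"
    "uniformity = (INF e\<in>{0 <..}. principal {(x, y::ell2Z). dist x y < e})"
    by (simp_all add: sgn_ell2Z_def dist_ell2Z_def uniformity_ell2Z_def)
  show "open U = (\<forall>x\<in>U. \<forall>\<^sub>F (x', y) in uniformity. x' = x \<longrightarrow> y \<in> U)" for U :: "ell2Z set"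
    by (simp add: open_ell2Z_def)
  have "inner x y = Re (cnj (\<Sum>\<^sub>\<infinity>l. coord x l * cnj (coord y l)))"
    by (simp add: inner_ell2Z_def)
  also have "\<dots> = inner y x"
    unfolding inner_ell2Z_def infsum_cnj[symmetric] by (simp add: mult.commute)
  finally show "inner x y = inner y x" .
  show "inner (x + y) z = inner x z + inner y z"
    unfolding inner_ell2Z_def by (simp add: algebra_simps infsum_add[OF ps ps])
  show "inner (r *\<^sub>R x) y = r * inner x y"
    unfolding inner_ell2Z_def by (simp add: mult.assoc infsum_cmult_right')
  have "inner x x = (\<Sum>\<^sub>\<infinity>l. Re (coord x l * cnj (coord x l)))"
    unfolding inner_ell2Z_def by (rule infsum_Re[OF ps, symmetric])
  then have ii: "inner x x = (\<Sum>\<^sub>\<infinity>l. (cmod (coord x l))\<^sup>2)"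
    unfolding complex_norm_square[symmetric] by simp
  show "norm x = sqrt (inner x x)" by (simp add: ii norm_ell2Z_def)
  show "0 \<le> inner x x" unfolding ii by (rule infsum_nonneg) simp
  show "(inner x x = 0) = (x = 0)"
  proof
    assume "inner x x = 0"
    then have "(\<Sum>\<^sub>\<infinity>l. (cmod (coord x l))\<^sup>2) \<le> 0" by (simp add: ii)
    from nonneg_infsum_le_0D[OF this coord_summable] have "(cmod (coord x l))\<^sup>2 = 0" for l
      by auto
    then show "x = 0" by (intro ell2Z_eqI) auto
  qed (simp add: inner_ell2Z_def)
qed

end

lemma norm_ell2Z_sq: "(norm x)\<^sup>2 = (\<Sum>\<^sub>\<infinity>l. (cmod (coord x l))\<^sup>2)"
  unfolding norm_ell2Z_def by (subst real_sqrt_pow2) (auto intro: infsum_nonneg)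

lemma finite_sum_le_norm:
  "finite F \<Longrightarrow> (\<Sum>l\<in>F. (cmod (coord x l))\<^sup>2) \<le> (norm x)\<^sup>2"
  unfolding norm_ell2Z_sq by (rule finite_sum_le_infsum[OF coord_summable]) auto

lemma norm_coord_le: "cmod (coord x l) \<le> norm x"
  using finite_sum_le_norm[of "{l}" x] by (simp add: power2_le_iff_abs_le)

lemma norm_le_if_finite_sums_le:
  assumes "\<And>F. finite F \<Longrightarrow> (\<Sum>l\<in>F. (cmod (coord x l))\<^sup>2) \<le> C\<^sup>2" "0 \<le> C"
  shows "norm x \<le> C"
proof -
  have "(norm x)\<^sup>2 \<le> C\<^sup>2" unfolding norm_ell2Z_sq
    by (rule infsum_le_finite_sums[OF coord_summable assms(1)])
  with assms(2) show ?thesis by (simp add: power2_le_iff_abs_le)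
qed

instance ell2Z :: complete_space
proof
  fix X :: "nat \<Rightarrow> ell2Z" assume C: "Cauchy X"
  have "Cauchy (\<lambda>n. coord (X n) l)" for l
  proof (rule metric_CauchyI)
    fix e :: real assume "e > 0"
    with C obtain M where M: "\<And>m n. m \<ge> M \<Longrightarrow> n \<ge> M \<Longrightarrow> dist (X m) (X n) < e"
      by (meson metric_CauchyD)
    have "dist (coord (X m) l) (coord (X n) l) < e" if "m \<ge> M" "n \<ge> M" for m n
      using M[OF that] norm_coord_le[of "X m - X n" l] by (simp add: dist_norm)
    then show "\<exists>M. \<forall>m\<ge>M. \<forall>n\<ge>M. dist (coord (X m) l) (coord (X n) l) < e" by blast
  qed
  then have "\<exists>a. (\<lambda>n. coord (X n) l) \<longlonglongrightarrow> a" for l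
    using Cauchy_convergent_iff convergent_def by blast
  then obtain y where y: "\<And>l. (\<lambda>n. coord (X n) l) \<longlonglongrightarrow> y l" by metis
  have lim: "(\<Sum>l\<in>F. (cmod (coord (X m) l - y l))\<^sup>2) \<le> e\<^sup>2"
    if fin: "finite F" and near: "\<And>n. n \<ge> M \<Longrightarrow> dist (X m) (X n) \<le> e" for F m M e
  proof (rule LIMSEQ_le_const2)
    show "(\<lambda>n. \<Sum>l\<in>F. (cmod (coord (X m) l - coord (X n) l))\<^sup>2) \<longlonglongrightarrow> (\<Sum>l\<in>F. (cmod (coord (X m) l - y l))\<^sup>2)"
      by (intro tendsto_intros y)
    have "(\<Sum>l\<in>F. (cmod (coord (X m) l - coord (X n) l))\<^sup>2) \<le> e\<^sup>2" if n: "n \<ge> M" for n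
    proof -
      have "(norm (X m - X n))\<^sup>2 \<le> e\<^sup>2"
        using near[OF n] by (simp add: dist_norm power_mono)
      with finite_sum_le_norm[OF fin, of "X m - X n"] show ?thesis by simp
    qed
    then show "\<exists>N. \<forall>n\<ge>N. (\<Sum>l\<in>F. (cmod (coord (X m) l - coord (X n) l))\<^sup>2) \<le> e\<^sup>2" by blast
  qed
  obtain M where M: "\<And>m n. m \<ge> M \<Longrightarrow> n \<ge> M \<Longrightarrow> dist (X m) (X n) < 1"
    using metric_CauchyD[OF C, of 1] by auto
  have "(\<lambda>l. (cmod (coord (X M) l - y l))\<^sup>2) summable_on UNIV"
  proof (rule nonneg_bdd_above_summable_on)
    show "bdd_above (sum (\<lambda>l. (cmod (coord (X M) l - y l))\<^sup>2) ` {F. F \<subseteq> UNIV \<and> finite F})"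
      by (rule bdd_aboveI[of _ "1\<^sup>2"]) (use lim[of _ M M 1] less_imp_le[OF M[of M]] in auto)
  qed simp
  then have "(\<lambda>l. (cmod (coord (X M) l + - (coord (X M) l - y l)))\<^sup>2) summable_on UNIV"
    by (intro l2_add_summable coord_summable) (simp add: norm_minus_commute)
  then have ys: "(\<lambda>l. (cmod (y l))\<^sup>2) summable_on UNIV" by simp
  define Y where "Y = Abs_ell2Z y"
  have cY: "coord Y = y" using ys by (simp add: Y_def Abs_ell2Z_inverse)
  have "X \<longlonglongrightarrow> Y"
  proof (rule metric_LIMSEQ_I)
    fix e :: real assume e: "e > 0"
    with C obtain M where M: "\<And>m n. m \<ge> M \<Longrightarrow> n \<ge> M \<Longrightarrow> dist (X m) (X n) < e/2"
      by (meson metric_CauchyD half_gt_zero)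
    have "dist (X m) Y < e" if "m \<ge> M" for m
    proof -
      have "norm (X m - Y) \<le> e/2"
        using lim[of _ M m "e/2"] less_imp_le[OF M[OF that]] e
        by (intro norm_le_if_finite_sums_le) (auto simp: cY)
      with e show ?thesis by (simp add: dist_norm)
    qed
    then show "\<exists>no. \<forall>n\<ge>no. dist (X n) Y < e" by blast
  qed
  then show "convergent X" by (auto simp: convergent_def)
qed

instance ell2Z :: banach ..

section \<open>Operators and the Bunce-Deddens algebra\<close>

text \<open>
  Operators are elements of the library type of bounded real-linear maps. The algebras below consist of
  complex-linear maps only, because their generators are complex-linear.
\<close>

type_synonym ell2_op = "ell2Z \<Rightarrow>\<^sub>L ell2Z"

definition cinner :: "ell2Z \<Rightarrow> ell2Z \<Rightarrow> complex" where
  "cinner x y = (\<Sum>\<^sub>\<infinity>l. coord x l * cnj (coord y l))"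

definition basis_vec :: "int \<Rightarrow> ell2Z" where
  "basis_vec l = Abs_ell2Z (\<lambda>j. if j = l then 1 else 0)"

definition diag_op :: "(int \<Rightarrow> complex) \<Rightarrow> ell2_op" where
  "diag_op b = Blinfun (\<lambda>x. Abs_ell2Z (\<lambda>l. b l * coord x l))"

text \<open>
  \<open>shift_op k\<close> is the power \<open>V^k\<close> of the bilateral shift, for any integer \<open>k\<close>: it maps the
  basis vector \<open>E_l\<close> to \<open>E_(l+k)\<close>; see \<open>shift_op_basis_vec\<close>, \<open>shift_op_add\<close> and \<open>shift_op_0\<close> below.
\<close>

definition shift_op :: "int \<Rightarrow> ell2_op" where
  "shift_op k = Blinfun (\<lambda>x. Abs_ell2Z (\<lambda>l. coord x (l - k)))"

definition cscale_op :: "complex \<Rightarrow> ell2_op \<Rightarrow> ell2_op" where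
  "cscale_op c A = diag_op (\<lambda>_. c) o\<^sub>L A"

definition op_adjoint :: "ell2_op \<Rightarrow> ell2_op" where
  "op_adjoint A = (THE B :: ell2_op. \<forall>x y. cinner (A x) y = cinner x (B y))"

text \<open>\<open>bd_alg N\<close> is the C*-algebra \<open>B(N)\<close>; \<open>bd_poly N\<close> is its dense *-subalgebra of polynomials in the generators.\<close>

definition star_subalgebra :: "ell2_op set \<Rightarrow> bool" where
  "star_subalgebra S \<longleftrightarrow> 0 \<in> S \<and>
     (\<forall>A\<in>S. \<forall>B\<in>S. A + B \<in> S \<and> A o\<^sub>L B \<in> S) \<and>
     (\<forall>c. \<forall>A\<in>S. cscale_op c A \<in> S) \<and>
     (\<forall>A\<in>S. op_adjoint A \<in> S)"

definition B_diag :: "nat \<Rightarrow> ell2_op set" where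
  "B_diag N = {diag_op b | b. bounded (range b) \<and> (\<exists>j. j dvd N \<and> (\<forall>l. b (l + int j) = b l))}"

definition bd_poly :: "nat \<Rightarrow> ell2_op set" where
  "bd_poly N = \<Inter>{S. star_subalgebra S \<and> {shift_op 1, shift_op (- 1)} \<union> B_diag N \<subseteq> S}"

definition bd_alg :: "nat \<Rightarrow> ell2_op set" where
  "bd_alg N = \<Inter>{S. star_subalgebra S \<and> closed S \<and> {shift_op 1} \<union> B_diag N \<subseteq> S}"

text \<open>Functions on the circle are represented as \<open>2\<pi>\<close>-periodic functions of the angle \<open>t\<close>.\<close>

definition C_circle :: "(real \<Rightarrow> complex) set" where
  "C_circle = {f. continuous_on UNIV f \<and> (\<forall>t. f (t + 2 * pi) = f t)}"

definition C_circle_mat :: "nat \<Rightarrow> (real \<Rightarrow> complex mat) set" where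
  "C_circle_mat N = {F. (\<forall>t. F t \<in> carrier_mat N N) \<and>
      (\<forall>i<N. \<forall>j<N. (\<lambda>t. F t $$ (i, j)) \<in> C_circle)}"

definition mat_unit :: "nat \<Rightarrow> nat \<Rightarrow> nat \<Rightarrow> complex mat" where
  "mat_unit N s r = Matrix.mat N N (\<lambda>(i, j). if i = s \<and> j = r then 1 else 0)"

definition P_op :: "nat \<Rightarrow> nat \<Rightarrow> nat \<Rightarrow> ell2_op" where
  "P_op N s r = shift_op (int s) o\<^sub>L diag_op (\<lambda>l. if int N dvd l then 1 else 0) o\<^sub>L shift_op (- int r)"

text \<open>
  \<open>\<Phi>\<close> is a *-isomorphism of \<open>B(N)\<close> onto the matrix-valued continuous functions on the circle which sends
  \<open>P_(sr)\<close> to the standard matrix unit and \<open>V^N\<close> to \<open>e^(it)\<close>. Its values off \<open>bd_alg N\<close> are irrelevant.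
  Existence is shown in \<open>bd_identification_exists\<close>.
\<close>

definition bd_identification :: "nat \<Rightarrow> (ell2_op \<Rightarrow> real \<Rightarrow> complex mat) \<Rightarrow> bool" where
  "bd_identification N \<Phi> \<longleftrightarrow>
     bij_betw \<Phi> (bd_alg N) (C_circle_mat N) \<and>
     (\<forall>A\<in>bd_alg N. \<forall>B\<in>bd_alg N. \<Phi> (A + B) = (\<lambda>t. \<Phi> A t + \<Phi> B t)) \<and>
     (\<forall>c. \<forall>A\<in>bd_alg N. \<Phi> (cscale_op c A) = (\<lambda>t. c \<cdot>\<^sub>m \<Phi> A t)) \<and>
     (\<forall>A\<in>bd_alg N. \<forall>B\<in>bd_alg N. \<Phi> (A o\<^sub>L B) = (\<lambda>t. \<Phi> A t * \<Phi> B t)) \<and>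
     (\<forall>A\<in>bd_alg N. \<Phi> (op_adjoint A) = (\<lambda>t. mat_adjoint (\<Phi> A t))) \<and>
     (\<forall>s<N. \<forall>r<N. \<Phi> (P_op N s r) = (\<lambda>t. mat_unit N s r)) \<and>
     \<Phi> (shift_op (int N)) = (\<lambda>t. cis t \<cdot>\<^sub>m 1\<^sub>m N)"

definition bd_derivation :: "nat \<Rightarrow> (ell2_op \<Rightarrow> ell2_op) \<Rightarrow> bool" where
  "bd_derivation N \<delta> \<longleftrightarrow>
     (\<forall>a\<in>bd_poly N. \<delta> a \<in> bd_alg N) \<and>
     (\<forall>a\<in>bd_poly N. \<forall>b\<in>bd_poly N. \<delta> (a + b) = \<delta> a + \<delta> b) \<and>
     (\<forall>c. \<forall>a\<in>bd_poly N. \<delta> (cscale_op c a) = cscale_op c (\<delta> a)) \<and>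
     (\<forall>a\<in>bd_poly N. \<forall>b\<in>bd_poly N. \<delta> (a o\<^sub>L b) = (\<delta> a o\<^sub>L b) + (a o\<^sub>L \<delta> b))"

definition bd_inner_derivation :: "nat \<Rightarrow> (ell2_op \<Rightarrow> ell2_op) \<Rightarrow> bool" where
  "bd_inner_derivation N \<delta> \<longleftrightarrow> bd_derivation N \<delta> \<and>
     (\<exists>z\<in>bd_alg N. \<forall>b\<in>bd_poly N. \<delta> b = (z o\<^sub>L b) - (b o\<^sub>L z))"

definition circle_derivation ::
  "nat \<Rightarrow> (real \<Rightarrow> complex) \<Rightarrow> (real \<Rightarrow> complex mat) \<Rightarrow> real \<Rightarrow> complex mat" where
  "circle_derivation N f F t = Matrix.mat N N (\<lambda>(i, j).
     f t * ((1 / \<i>) * vector_derivative (\<lambda>u. F u $$ (i, j)) (at t)))"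

text \<open>The derivation \<open>F \<mapsto> f \<cdot> (1/i) dF/dt\<close>, transported to operators along the identification \<open>\<Phi>\<close>.\<close>

definition bd_delta ::
  "nat \<Rightarrow> (ell2_op \<Rightarrow> real \<Rightarrow> complex mat) \<Rightarrow> (real \<Rightarrow> complex) \<Rightarrow> ell2_op \<Rightarrow> ell2_op" where
  "bd_delta N \<Phi> f b = inv_into (bd_alg N) \<Phi> (circle_derivation N f (\<Phi> b))"

lemma diag_op_bl:
  assumes "\<And>l. cmod (b l) \<le> C"
  shows "bounded_linear (\<lambda>x. Abs_ell2Z (\<lambda>l. b l * coord x l))"
    and coord_diag_op': "coord (Abs_ell2Z (\<lambda>l. b l * coord x l)) = (\<lambda>l. b l * coord x l)"
    and norm_diag_op': "norm (Abs_ell2Z (\<lambda>l. b l * coord x l)) \<le> C * norm x"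
proof -
  have c: "coord (Abs_ell2Z (\<lambda>l. b l * coord x l)) = (\<lambda>l. b l * coord x l)" for x
    using l2_bounded_mult_summable[OF coord_summable assms] by (simp add: Abs_ell2Z_inverse)
  have C: "C \<ge> 0" using assms[of 0] norm_ge_zero order_trans by blast
  have n: "norm (Abs_ell2Z (\<lambda>l. b l * coord x l)) \<le> C * norm x" for x
  proof (rule norm_le_if_finite_sums_le)
    fix F :: "int set" assume F: "finite F"
    have "(\<Sum>l\<in>F. (cmod (coord (Abs_ell2Z (\<lambda>l. b l * coord x l)) l))\<^sup>2) \<le> (\<Sum>l\<in>F. C\<^sup>2 * (cmod (coord x l))\<^sup>2)"
      by (rule sum_mono) (simp add: c norm_mult power_mult_distrib mult_right_mono power_mono assms)
    also have "\<dots> \<le> C\<^sup>2 * (norm x)\<^sup>2"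
      unfolding sum_distrib_left[symmetric] by (intro mult_left_mono finite_sum_le_norm F) auto
    finally show "(\<Sum>l\<in>F. (cmod (coord (Abs_ell2Z (\<lambda>l. b l * coord x l)) l))\<^sup>2) \<le> (C * norm x)\<^sup>2"
      by (simp add: power_mult_distrib)
  qed (use C in auto)
  show "bounded_linear (\<lambda>x. Abs_ell2Z (\<lambda>l. b l * coord x l))"
  proof (rule bounded_linear_intro[of _ C])
    show "norm (Abs_ell2Z (\<lambda>l. b l * coord x l)) \<le> norm x * C" for x
      using n[of x] by (simp add: mult.commute)
    fix x y r
    show "Abs_ell2Z (\<lambda>l. b l * coord (x + y) l) = Abs_ell2Z (\<lambda>l. b l * coord x l) + Abs_ell2Z (\<lambda>l. b l * coord y l)"
      by (rule ell2Z_eqI, subst c, simp add: c algebra_simps)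
    show "Abs_ell2Z (\<lambda>l. b l * coord (r *\<^sub>R x) l) = r *\<^sub>R Abs_ell2Z (\<lambda>l. b l * coord x l)"
      by (rule ell2Z_eqI, subst c, simp add: c)
  qed
  show "coord (Abs_ell2Z (\<lambda>l. b l * coord x l)) = (\<lambda>l. b l * coord x l)" 
    "norm (Abs_ell2Z (\<lambda>l. b l * coord x l)) \<le> C * norm x" using c n by auto
qed

lemma coord_diag_op:
  assumes "\<And>l. cmod (b l) \<le> C" shows "coord (diag_op b x) l = b l * coord x l"
  unfolding diag_op_def
  by (subst bounded_linear_Blinfun_apply[OF diag_op_bl(1)[OF assms]], subst coord_diag_op'[OF assms]) simp

lemma norm_diag_op:
  assumes "\<And>l. cmod (b l) \<le> C" shows "norm (diag_op b) \<le> C"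
  unfolding diag_op_def
proof (rule norm_blinfun_bound)
  show "0 \<le> C" using assms[of 0] norm_ge_zero order_trans by blast
  show "norm (Blinfun (\<lambda>x. Abs_ell2Z (\<lambda>l. b l * coord x l)) x) \<le> C * norm x" for x
    by (subst bounded_linear_Blinfun_apply[OF diag_op_bl(1)[OF assms]]) (rule norm_diag_op'[OF assms])
qed

lemma shift_op_bl:
  shows "bounded_linear (\<lambda>x. Abs_ell2Z (\<lambda>l. coord x (l - k)))"
    and coord_shift_op': "coord (Abs_ell2Z (\<lambda>l. coord x (l - k))) = (\<lambda>l. coord x (l - k))"
    and norm_shift_op': "norm (Abs_ell2Z (\<lambda>l. coord x (l - k))) \<le> norm x"
proof -
  have c: "coord (Abs_ell2Z (\<lambda>l. coord x (l - k))) = (\<lambda>l. coord x (l - k))" for x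
    using l2_shift_summable[OF coord_summable] by (simp add: Abs_ell2Z_inverse)
  have n: "norm (Abs_ell2Z (\<lambda>l. coord x (l - k))) \<le> norm x" for x
  proof (rule norm_le_if_finite_sums_le)
    fix F :: "int set" assume F: "finite F"
    have "(\<Sum>l\<in>F. (cmod (coord (Abs_ell2Z (\<lambda>l. coord x (l - k))) l))\<^sup>2) = (\<Sum>l\<in>(\<lambda>l. l - k) ` F. (cmod (coord x l))\<^sup>2)"
      by (subst sum.reindex) (auto simp: c inj_on_def)
    also have "\<dots> \<le> (norm x)\<^sup>2"
      by (intro finite_sum_le_norm) (use F in auto)
    finally show "(\<Sum>l\<in>F. (cmod (coord (Abs_ell2Z (\<lambda>l. coord x (l - k))) l))\<^sup>2) \<le> (norm x)\<^sup>2" .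
  qed auto
  show "bounded_linear (\<lambda>x. Abs_ell2Z (\<lambda>l. coord x (l - k)))"
  proof (rule bounded_linear_intro[of _ 1])
    show "norm (Abs_ell2Z (\<lambda>l. coord x (l - k))) \<le> norm x * 1" for x
      using n[of x] by simp
    fix x y r
    show "Abs_ell2Z (\<lambda>l. coord (x + y) (l - k)) = Abs_ell2Z (\<lambda>l. coord x (l - k)) + Abs_ell2Z (\<lambda>l. coord y (l - k))"
      by (rule ell2Z_eqI, subst c, simp add: c)
    show "Abs_ell2Z (\<lambda>l. coord (r *\<^sub>R x) (l - k)) = r *\<^sub>R Abs_ell2Z (\<lambda>l. coord x (l - k))"
      by (rule ell2Z_eqI, subst c, simp add: c)
  qed
  show "coord (Abs_ell2Z (\<lambda>l. coord x (l - k))) = (\<lambda>l. coord x (l - k))" 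
    "norm (Abs_ell2Z (\<lambda>l. coord x (l - k))) \<le> norm x" using c n by auto
qed

lemma coord_shift_op [simp]: "coord (shift_op k x) l = coord x (l - k)"
  unfolding shift_op_def by (simp add: bounded_linear_Blinfun_apply[OF shift_op_bl(1)] coord_shift_op')

lemma coord_basis_vec [simp]: "coord (basis_vec l) j = (if j = l then 1 else 0)"
proof -
  have "(\<lambda>j. (cmod (if j = l then 1 else 0))\<^sup>2) summable_on {l}" by (rule summable_on_finite) simp
  then have "(\<lambda>j. (cmod (if j = l then 1 else 0))\<^sup>2) summable_on UNIV"
    by (rule summable_on_cong_neutral[THEN iffD1, rotated -1]) auto
  then show ?thesis by (simp add: basis_vec_def Abs_ell2Z_inverse)
qed

lemma shift_op_basis_vec: "shift_op k (basis_vec l) = basis_vec (l + k)"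
  by (rule ell2Z_eqI) auto

lemma diag_op_basis_vec:
  assumes "bounded (range b)"
  shows "coord (diag_op b (basis_vec l)) j = b l * coord (basis_vec l) j"
proof -
  obtain C where "\<And>l. cmod (b l) \<le> C" using assms by (auto simp: bounded_iff)
  then show ?thesis by (simp add: coord_diag_op[of b C])
qed

lemma shift_op_add: "shift_op i o\<^sub>L shift_op j = shift_op (i + j)"
  by (intro blinfun_eqI ell2Z_eqI) (simp add: algebra_simps)

lemma shift_op_0: "shift_op 0 = id_blinfun"
  by (intro blinfun_eqI ell2Z_eqI) simp

lemma coord_scalar [simp]: "coord (diag_op (\<lambda>_. c) x) l = c * coord x l"
  by (rule coord_diag_op[of _ "cmod c"]) simp

lemma coord_cscale_op [simp]: "coord (cscale_op c A x) l = c * coord (A x) l"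
  by (simp add: cscale_op_def)

lemma coord_blinfun_add [simp]: "coord ((A + B :: ell2_op) x) l = coord (A x) l + coord (B x) l"
  by (simp add: blinfun.bilinear_simps)
lemma coord_blinfun_diff [simp]: "coord ((A - B :: ell2_op) x) l = coord (A x) l - coord (B x) l"
  by (simp add: blinfun.bilinear_simps)
lemma coord_blinfun_0 [simp]: "coord ((0 :: ell2_op) x) l = 0"
  by simp
lemma coord_sum: "coord (\<Sum>i\<in>I. g i) l = (\<Sum>i\<in>I. coord (g i) l)"
  by (induction I rule: infinite_finite_induct) auto
lemma coord_blinfun_sum: "coord ((\<Sum>i\<in>I. G i :: ell2_op) x) l = (\<Sum>i\<in>I. coord (G i x) l)"
  by (induction I rule: infinite_finite_induct) auto

lemma op_eqI: "(\<And>x l. coord ((A :: ell2_op) x) l = coord ((B :: ell2_op) x) l) \<Longrightarrow> A = B"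
  by (intro blinfun_eqI ell2Z_eqI) auto

definition is_adj :: "ell2_op \<Rightarrow> ell2_op \<Rightarrow> bool" where
  "is_adj A B \<longleftrightarrow> (\<forall>x y. cinner (A x) y = cinner x (B y))"

lemmas cin_summable = l2_prod_summable[OF coord_summable coord_summable]

lemma cinner_add_left: "cinner (x + y) z = cinner x z + cinner y z"
  unfolding cinner_def by (simp add: algebra_simps infsum_add[OF cin_summable cin_summable])
lemma cinner_cnj: "cnj (cinner x y) = cinner y x"
  unfolding cinner_def infsum_cnj[symmetric] by (simp add: mult.commute)
lemma cinner_add_right: "cinner z (x + y) = cinner z x + cinner z y"
  by (metis cinner_cnj cinner_add_left complex_cnj_add)
lemma cinner_scale_left: "cinner (diag_op (\<lambda>_. c) x) y = c * cinner x y"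
  unfolding cinner_def by (simp add: mult.assoc infsum_cmult_right')
lemma cinner_scale_right: "cinner y (diag_op (\<lambda>_. c) x) = cnj c * cinner y x"
  by (metis cinner_cnj cinner_scale_left complex_cnj_mult)
lemma Re_cinner: "Re (cinner x y) = inner x y"
  unfolding cinner_def inner_ell2Z_def ..
lemma cinner_basis: "cinner x (basis_vec l) = coord x l"
proof -
  have "cinner x (basis_vec l) = (\<Sum>\<^sub>\<infinity>j\<in>{l}. coord x j * cnj (coord (basis_vec l) j))"
    unfolding cinner_def by (rule infsum_cong_neutral) auto
  then show ?thesis by simp
qed
lemma norm_cinner: "cmod (cinner x y) \<le> norm x * norm y"
proof (cases "cinner x y = 0")
  case False
  define c where "c = cnj (cinner x y) / cmod (cinner x y)"
  have c1: "cmod c = 1" using False by (simp add: c_def norm_divide)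
  have "c * cinner x y = of_real (cmod (cinner x y))"
    using False by (simp add: c_def mult.commute[of "cnj _"] complex_norm_square[symmetric] power2_eq_square)
  then have "cmod (cinner x y) = Re (cinner (diag_op (\<lambda>_. c) x) y)"
    by (simp add: cinner_scale_left)
  also have "\<dots> \<le> norm (diag_op (\<lambda>_. c) x) * norm y"
    by (simp add: Re_cinner norm_cauchy_schwarz)
  also have "\<dots> \<le> norm x * norm y"
  proof (rule mult_right_mono)
    have "norm (diag_op (\<lambda>_. c) x) \<le> norm (diag_op (\<lambda>_. c)) * norm x" by (rule norm_blinfun)
    also have "\<dots> \<le> 1 * norm x" by (intro mult_right_mono norm_diag_op) (auto simp: c1)
    finally show "norm (diag_op (\<lambda>_. c) x) \<le> norm x" by simp
  qed simp
  finally show ?thesis .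
qed simp

lemma is_adj_unique: "is_adj A B \<Longrightarrow> is_adj A C \<Longrightarrow> B = C"
proof (rule op_eqI)
  fix x l assume "is_adj A B" "is_adj A C"
  then have "cinner (basis_vec l) (B x) = cinner (basis_vec l) (C x)" by (simp add: is_adj_def)
  then show "coord (B x) l = coord (C x) l" by (metis cinner_cnj cinner_basis)
qed

lemma op_adjoint_eqI: "is_adj A B \<Longrightarrow> op_adjoint A = B"
  unfolding op_adjoint_def is_adj_def[symmetric] by (rule the_equality) (auto dest: is_adj_unique)

lemma is_adj_0: "is_adj 0 0"
  by (simp add: is_adj_def cinner_def)
lemma is_adj_id: "is_adj id_blinfun id_blinfun"
  by (simp add: is_adj_def)
lemma is_adj_add: "is_adj A B \<Longrightarrow> is_adj A' B' \<Longrightarrow> is_adj (A + A') (B + B')"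
  by (simp add: is_adj_def blinfun.bilinear_simps cinner_add_left cinner_add_right)
lemma is_adj_comp: "is_adj A B \<Longrightarrow> is_adj A' B' \<Longrightarrow> is_adj (A o\<^sub>L A') (B' o\<^sub>L B)"
  by (simp add: is_adj_def)
lemma is_adj_diag: 
  assumes "\<And>l. cmod (b l) \<le> C"
  shows "is_adj (diag_op b) (diag_op (\<lambda>l. cnj (b l)))"
  using assms by (simp add: is_adj_def cinner_def coord_diag_op[of _ C] mult_ac)
lemma is_adj_scalar: "is_adj (diag_op (\<lambda>_. c)) (diag_op (\<lambda>_. cnj c))"
  by (rule is_adj_diag[of _ "cmod c"]) simp
lemma is_adj_shift: "is_adj (shift_op k) (shift_op (- k))"
  unfolding is_adj_def
proof (intro allI)
  fix x y
  have "bij (\<lambda>l::int. l + k)"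
    by (rule bij_betwI[of _ _ _ "\<lambda>l. l - k"]) auto
  from infsum_reindex_bij_betw[OF this, of "\<lambda>l. coord x (l - k) * cnj (coord y l)"]
  show "cinner (shift_op k x) y = cinner x (shift_op (- k) y)"
    by (simp add: cinner_def)
qed
lemma is_adj_sum: "(\<And>i. i \<in> I \<Longrightarrow> is_adj (A i) (B i)) \<Longrightarrow> is_adj (\<Sum>i\<in>I. A i) (\<Sum>i\<in>I. B i)"
  by (induction I rule: infinite_finite_induct) (auto intro: is_adj_0 is_adj_add)

lemma cinner_tendsto:
  assumes "X \<longlonglongrightarrow> x" shows "(\<lambda>n. cinner (X n) y) \<longlonglongrightarrow> cinner x y" "(\<lambda>n. cinner y (X n)) \<longlonglongrightarrow> cinner y x"
proof -
  have e: "cinner (X n) y - cinner x y = cinner (X n - x) y" for n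
    using cinner_add_left[of "X n - x" x y] by simp
  show *: "(\<lambda>n. cinner (X n) y) \<longlonglongrightarrow> cinner x y" for y
  proof (rule LIM_zero_cancel, rule Lim_null_comparison)
    show "\<forall>\<^sub>F n in sequentially. cmod (cinner (X n) y - cinner x y) \<le> norm (X n - x) * norm y"
      using norm_cinner[of "X _ - x" y] cinner_add_left[of "X _ - x" x y] by simp
    have "(\<lambda>n. norm (X n - x)) \<longlonglongrightarrow> 0" using assms LIM_zero tendsto_norm_zero by blast
    then show "(\<lambda>n. norm (X n - x) * norm y) \<longlonglongrightarrow> 0" by (rule tendsto_mult_left_zero)
  qed
  show "(\<lambda>n. cinner y (X n)) \<longlonglongrightarrow> cinner y x"
    using tendsto_cnj[OF *[of y]] by (simp add: cinner_cnj)
qed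

lemma is_adj_lim:
  assumes "\<And>n. is_adj (A n) (B n)" "A \<longlonglongrightarrow> A'" "B \<longlonglongrightarrow> B'"
  shows "is_adj A' B'"
  unfolding is_adj_def
proof (intro allI)
  fix x y
  have "(\<lambda>n. A n x) \<longlonglongrightarrow> A' x" "(\<lambda>n. B n y) \<longlonglongrightarrow> B' y"
    using assms(2,3) by (auto intro!: tendsto_intros)
  then have "(\<lambda>n. cinner (A n x) y) \<longlonglongrightarrow> cinner (A' x) y" "(\<lambda>n. cinner x (B n y)) \<longlonglongrightarrow> cinner x (B' y)"
    by (auto intro: cinner_tendsto)
  then show "cinner (A' x) y = cinner x (B' y)"
    using assms(1) LIMSEQ_unique by (simp add: is_adj_def) blast
qed

section \<open>Existence of the identification with matrix-valued functions\<close>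

lemma cis_has_integral:
  "((\<lambda>t. cis (of_int k * t)) has_integral (if k = 0 then 2 * pi else 0)) {0..2 * pi}"
proof (cases "k = 0")
  case True
  then show ?thesis using has_integral_const_real[of "1::complex" 0 "2 * pi"] by (simp add: scaleR_conv_of_real)
next
  case False
  have "((\<lambda>t. cis (of_int k * t)) has_integral
      (cis (of_int k * (2 * pi)) / (\<i> * of_int k) - cis (of_int k * 0) / (\<i> * of_int k))) {0..2 * pi}"
  proof (rule fundamental_theorem_of_calculus)
    fix t
    have "((\<lambda>z::complex. exp (\<i> * of_int k * z)) has_field_derivative (\<i> * of_int k * exp (\<i> * of_int k * of_real t))) (at (of_real t))"
      by (auto intro!: derivative_eq_intros)
    from has_vector_derivative_real_field[OF this, of "{0..2*pi}"]
    have "((\<lambda>t. cis (of_int k * t)) has_vector_derivative (of_int k * (\<i> * cis (of_int k * t)))) (at t within {0..2*pi})"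
      by (simp add: cis_conv_exp mult_ac)
    from has_vector_derivative_mult_left[OF this, of "1 / (\<i> * of_int k)"] False
    show "((\<lambda>t. cis (of_int k * t) / (\<i> * of_int k)) has_vector_derivative cis (of_int k * t)) (at t within {0..2 * pi})"
      by (simp add: field_simps)
  qed simp
  moreover have "cis (of_int k * (2 * pi)) = 1" by (rule cis_multiple_2pi[THEN trans[rotated]]) (auto simp: mult_ac)
  ultimately show ?thesis using False by simp
qed

lemma parseval:
  assumes "finite T"
  shows "((\<lambda>t. (cmod (\<Sum>l\<in>T. v l * cis (of_int l * t)))\<^sup>2) has_integral 2 * pi * (\<Sum>l\<in>T. (cmod (v l))\<^sup>2)) {0..2 * pi}"
proof -
  have "((\<lambda>t. \<Sum>l\<in>T. \<Sum>m\<in>T. v l * cnj (v m) * cis (of_int (l - m) * t)) has_integral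
     (\<Sum>l\<in>T. \<Sum>m\<in>T. v l * cnj (v m) * (if l - m = 0 then 2 * pi else 0))) {0..2 * pi}"
    by (intro has_integral_sum has_integral_mult_right cis_has_integral assms)
  moreover have "(\<Sum>l\<in>T. \<Sum>m\<in>T. v l * cnj (v m) * cis (of_int (l - m) * t)) = of_real ((cmod (\<Sum>l\<in>T. v l * cis (of_int l * t)))\<^sup>2)" for t
    unfolding complex_norm_square cnj_sum sum_product
    by (intro sum.cong refl) (simp add: cis_cnj cis_mult algebra_simps)
  moreover have "(\<Sum>l\<in>T. \<Sum>m\<in>T. v l * cnj (v m) * (if l - m = 0 then 2 * pi else 0)) = of_real (2 * pi * (\<Sum>l\<in>T. (cmod (v l))\<^sup>2))"
    unfolding of_real_mult of_real_sum sum_distrib_left complex_norm_square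
    by (intro sum.cong refl) (simp add: mult_ac if_distrib[of "\<lambda>x. _ * x"] if_distrib[of of_real] assms cong: if_cong)
  ultimately have "((\<lambda>t. complex_of_real ((cmod (\<Sum>l\<in>T. v l * cis (of_int l * t)))\<^sup>2)) has_integral of_real (2 * pi * (\<Sum>l\<in>T. (cmod (v l))\<^sup>2))) {0..2 * pi}"
    by simp
  from has_integral_linear[OF this bounded_linear_Re] show ?thesis by (simp add: o_def)
qed

definition tp :: "nat \<Rightarrow> (nat \<Rightarrow> complex) \<Rightarrow> (nat \<Rightarrow> int) \<Rightarrow> real \<Rightarrow> complex" where
  "tp n c k t = (\<Sum>i<n. c i * cis (of_int (k i) * t))"
definition tpop :: "nat \<Rightarrow> nat \<Rightarrow> (nat \<Rightarrow> complex) \<Rightarrow> (nat \<Rightarrow> int) \<Rightarrow> ell2_op" where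
  "tpop N n c k = (\<Sum>i<n. cscale_op (c i) (shift_op (int N * k i)))"

lemma coord_tpop: "coord (tpop N n c k x) l = (\<Sum>i<n. c i * coord x (l - int N * k i))"
  by (simp add: tpop_def coord_blinfun_sum)

lemma tpop_upper_finite:
  fixes u :: "int \<Rightarrow> complex"
  assumes S: "finite S" and m: "\<And>t. cmod (tp n c k t) \<le> m" and F: "finite F"
    and u: "\<And>l. l \<notin> S \<Longrightarrow> u l = 0"
  shows "(\<Sum>l\<in>F. (cmod (\<Sum>i<n. c i * u (l - int N * k i)))\<^sup>2) \<le> m\<^sup>2 * (\<Sum>l\<in>S. (cmod (u l))\<^sup>2)"
proof -
  define G where "G = F \<union> (\<Union>i<n. (\<lambda>s. s + int N * k i) ` S)"
  have G: "finite G" using S F by (auto simp: G_def)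
  define y where "y l = (\<Sum>i<n. c i * u (l - int N * k i))" for l
  have m0: "m \<ge> 0" using m[of 0] norm_ge_zero order_trans by blast
  have sh: "(\<Sum>l\<in>G. u (l - int N * k i) * cis (of_int l * t))
     = (\<Sum>s\<in>S. u s * cis (of_int s * t)) * cis (of_int (k i) * (real N * t))" if "i < n" for i t
  proof -
    have "(\<Sum>l\<in>G. u (l - int N * k i) * cis (of_int l * t))
      = (\<Sum>l\<in>(\<lambda>s. s + int N * k i) ` S. u (l - int N * k i) * cis (of_int l * t))"
    proof (rule sum.mono_neutral_right[OF G])
      show "(\<lambda>s. s + int N * k i) ` S \<subseteq> G" using that by (auto simp: G_def)
      show "\<forall>l\<in>G - (\<lambda>s. s + int N * k i) ` S. u (l - int N * k i) * cis (of_int l * t) = 0"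
      proof
        fix l assume "l \<in> G - (\<lambda>s. s + int N * k i) ` S"
        then have "l - int N * k i \<notin> S" by (metis DiffD2 diff_add_cancel imageI)
        then show "u (l - int N * k i) * cis (of_int l * t) = 0" by (simp add: u)
      qed
    qed
    also have "\<dots> = (\<Sum>s\<in>S. u s * cis (of_int (s + int N * k i) * t))"
      by (subst sum.reindex) (auto simp: inj_on_def)
    also have "\<dots> = (\<Sum>s\<in>S. u s * cis (of_int s * t)) * cis (of_int (k i) * (real N * t))"
      unfolding sum_distrib_right by (intro sum.cong refl) (simp add: cis_mult mult.assoc algebra_simps)
    finally show ?thesis .
  qed
  have eq: "(\<Sum>l\<in>G. y l * cis (of_int l * t)) = tp n c k (real N * t) * (\<Sum>s\<in>S. u s * cis (of_int s * t))" for t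
  proof -
    have "(\<Sum>l\<in>G. y l * cis (of_int l * t)) = (\<Sum>i<n. c i * (\<Sum>l\<in>G. u (l - int N * k i) * cis (of_int l * t)))"
      unfolding y_def sum_distrib_right sum_distrib_left by (subst sum.swap) (simp add: mult.assoc)
    also have "\<dots> = tp n c k (real N * t) * (\<Sum>s\<in>S. u s * cis (of_int s * t))"
      unfolding tp_def sum_distrib_right by (rule sum.cong) (auto simp: sh)
    finally show ?thesis .
  qed
  have "2 * pi * (\<Sum>l\<in>G. (cmod (y l))\<^sup>2) \<le> m\<^sup>2 * (2 * pi * (\<Sum>s\<in>S. (cmod (u s))\<^sup>2))"
  proof (rule has_integral_le[OF parseval[OF G] has_integral_mult_right[OF parseval[OF S]]])
    show "(cmod (\<Sum>l\<in>G. y l * cis (of_int l * t)))\<^sup>2 \<le> m\<^sup>2 * (cmod (\<Sum>l\<in>S. u l * cis (of_int l * t)))\<^sup>2" for t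
      unfolding eq norm_mult power_mult_distrib by (intro mult_right_mono power_mono m) auto
  qed
  then have "(\<Sum>l\<in>G. (cmod (y l))\<^sup>2) \<le> m\<^sup>2 * (\<Sum>s\<in>S. (cmod (u s))\<^sup>2)"
    by (simp add: mult.left_commute[of "m\<^sup>2"])
  moreover have "(\<Sum>l\<in>F. (cmod (y l))\<^sup>2) \<le> (\<Sum>l\<in>G. (cmod (y l))\<^sup>2)"
    by (rule sum_mono2[OF G]) (auto simp: G_def)
  ultimately show ?thesis by (simp add: y_def)
qed

lemma tpop_upper:
  assumes m: "\<And>t. cmod (tp n c k t) \<le> m"
  shows "norm (tpop N n c k) \<le> m"
proof (rule norm_blinfun_bound)
  show m0: "m \<ge> 0" using m[of 0] norm_ge_zero order_trans by blast
  fix x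
  show "norm (tpop N n c k x) \<le> m * norm x"
  proof (rule norm_le_if_finite_sums_le)
    fix F :: "int set" assume F: "finite F"
    define S where "S = (\<Union>l\<in>F. (\<lambda>i. l - int N * k i) ` {..<n})"
    define u where "u l = (if l \<in> S then coord x l else 0)" for l
    have S: "finite S" using F by (auto simp: S_def)
    have "(\<Sum>l\<in>F. (cmod (coord (tpop N n c k x) l))\<^sup>2) = (\<Sum>l\<in>F. (cmod (\<Sum>i<n. c i * u (l - int N * k i)))\<^sup>2)"
    proof (rule sum.cong[OF refl])
      fix l assume "l \<in> F"
      then have "u (l - int N * k i) = coord x (l - int N * k i)" if "i < n" for i
        using that by (auto simp: u_def S_def)
      then show "(cmod (coord (tpop N n c k x) l))\<^sup>2 = (cmod (\<Sum>i<n. c i * u (l - int N * k i)))\<^sup>2"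
        by (simp add: coord_tpop)
    qed
    also have "\<dots> \<le> m\<^sup>2 * (\<Sum>l\<in>S. (cmod (u l))\<^sup>2)"
      by (rule tpop_upper_finite[OF S m F]) (simp add: u_def)
    also have "\<dots> \<le> m\<^sup>2 * (norm x)\<^sup>2"
      using finite_sum_le_norm[OF S, of x] by (intro mult_left_mono) (auto simp: u_def)
    finally show "(\<Sum>l\<in>F. (cmod (coord (tpop N n c k x) l))\<^sup>2) \<le> (m * norm x)\<^sup>2"
      by (simp add: power_mult_distrib)
  qed (use m0 in simp)
qed

lemma finite_support_vec:
  fixes u :: "int \<Rightarrow> complex"
  assumes "finite S" "\<And>l. l \<notin> S \<Longrightarrow> u l = 0"
  shows "coord (Abs_ell2Z u) = u" "(norm (Abs_ell2Z u))\<^sup>2 = (\<Sum>l\<in>S. (cmod (u l))\<^sup>2)"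
proof -
  have "(\<lambda>j. (cmod (u j))\<^sup>2) summable_on S" using assms(1) by (rule summable_on_finite)
  then have "(\<lambda>j. (cmod (u j))\<^sup>2) summable_on UNIV"
    by (rule summable_on_cong_neutral[THEN iffD1, rotated -1]) (auto simp: assms)
  then show c: "coord (Abs_ell2Z u) = u" by (simp add: Abs_ell2Z_inverse)
  have "(norm (Abs_ell2Z u))\<^sup>2 = (\<Sum>\<^sub>\<infinity>l\<in>S. (cmod (u l))\<^sup>2)"
    unfolding norm_ell2Z_sq c by (rule infsum_cong_neutral) (auto simp: assms)
  then show "(norm (Abs_ell2Z u))\<^sup>2 = (\<Sum>l\<in>S. (cmod (u l))\<^sup>2)" using assms(1) by simp
qed

lemma tpop_lower:
  assumes N: "N > 0"
  shows "cmod (tp n c k t) \<le> norm (tpop N n c k)"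
proof -
  define A where "A = tpop N n c k"
  define d where "d = (\<Sum>i<n. nat \<bar>k i\<bar>)"
  have d: "\<bar>k i\<bar> \<le> int d" if "i < n" for i
  proof -
    have "nat \<bar>k i\<bar> \<le> d" unfolding d_def by (rule member_le_sum) (use that in auto)
    then show ?thesis by linarith
  qed
  have key: "real M * (cmod (tp n c k t))\<^sup>2 \<le> (norm A)\<^sup>2 * (real M + 2 * d)" for M :: nat
  proof -
    define S where "S = (\<lambda>j. int N * j) ` {- int d..<int M + int d}"
    define u where "u l = (if l \<in> S then cis (- of_int (l div int N) * t) else 0)" for l
    have S: "finite S" by (simp add: S_def)
    have inj: "inj_on (\<lambda>j. int N * j) Z" for Z using N by (auto simp: inj_on_def)
    have cS: "card S = M + 2 * d" unfolding S_def by (subst card_image[OF inj]) simp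
    note fs = finite_support_vec[OF S, of u]
    define x where "x = Abs_ell2Z u"
    have cx: "coord x = u" and nx: "(norm x)\<^sup>2 = real M + 2 * d"
      using fs by (auto simp: x_def u_def cS)
    have uj: "u (int N * j) = cis (- of_int j * t)" if "- int d \<le> j" "j < int M + int d" for j
      using that N by (auto simp: u_def S_def)
    have cA: "coord (A x) (int N * j) = cis (- of_int j * t) * tp n c k t" if j: "0 \<le> j" "j < int M" for j
    proof -
      have "u (int N * j - int N * k i) = cis (- of_int j * t) * cis (of_int (k i) * t)" if "i < n" for i
      proof -
        have "u (int N * (j - k i)) = cis (- of_int (j - k i) * t)"
          using d[OF that] j by (intro uj) auto
        then show ?thesis by (simp add: cis_mult algebra_simps)
      qed
      then show ?thesis
        unfolding A_def coord_tpop cx tp_def sum_distrib_left by (intro sum.cong) auto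
    qed
    have "real M * (cmod (tp n c k t))\<^sup>2 = (\<Sum>l\<in>(\<lambda>j. int N * j) ` {0..<int M}. (cmod (coord (A x) l))\<^sup>2)"
      by (subst sum.reindex[OF inj]) (simp add: cA norm_mult)
    also have "\<dots> \<le> (norm (A x))\<^sup>2" by (rule finite_sum_le_norm) simp
    also have "\<dots> \<le> (norm A * norm x)\<^sup>2" by (intro power_mono norm_blinfun) simp
    finally show ?thesis by (simp add: power_mult_distrib nx)
  qed
  have "(cmod (tp n c k t))\<^sup>2 \<le> (norm A)\<^sup>2"
  proof (rule ccontr)
    assume "\<not> (cmod (tp n c k t))\<^sup>2 \<le> (norm A)\<^sup>2"
    then have pos: "(cmod (tp n c k t))\<^sup>2 - (norm A)\<^sup>2 > 0" by linarith
    then obtain M :: nat where "(norm A)\<^sup>2 * (2 * d) < real M * ((cmod (tp n c k t))\<^sup>2 - (norm A)\<^sup>2)"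
      using reals_Archimedean3 by blast
    with key[of M] show False by (simp add: algebra_simps)
  qed
  then show ?thesis unfolding A_def by (rule power2_le_imp_le) simp
qed

definition trig :: "nat \<Rightarrow> (real \<Rightarrow> complex) \<Rightarrow> ell2_op \<Rightarrow> bool" where
  "trig N p P \<longleftrightarrow> (\<exists>n c k. p = tp n c k \<and> P = tpop N n c k)"

abbreviation tmono :: "complex \<Rightarrow> int \<Rightarrow> real \<Rightarrow> complex" where
  "tmono c k \<equiv> (\<lambda>t. c * cis (of_int k * t))"
abbreviation tmonop :: "nat \<Rightarrow> complex \<Rightarrow> int \<Rightarrow> ell2_op" where
  "tmonop N c k \<equiv> cscale_op c (shift_op (int N * k))"

lemma trig_0: "trig N (\<lambda>_. 0) 0"
  unfolding trig_def by (rule exI[of _ 0]) (auto simp: tp_def tpop_def fun_eq_iff)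

lemma trig_add_mono:
  assumes "trig N p P" shows "trig N (\<lambda>t. p t + tmono c k t) (P + tmonop N c k)"
proof -
  obtain n c' k' where *: "p = tp n c' k'" "P = tpop N n c' k'" using assms by (auto simp: trig_def)
  show ?thesis unfolding trig_def
    by (rule exI[of _ "Suc n"], rule exI[of _ "c'(n := c)"], rule exI[of _ "k'(n := k)"])
       (auto simp: * tp_def tpop_def)
qed

lemma trig_induct [consumes 1, case_names 0 add]:
  assumes "trig N p P" "Q (\<lambda>_. 0) 0"
    and "\<And>p P c k. trig N p P \<Longrightarrow> Q p P \<Longrightarrow> Q (\<lambda>t. p t + tmono c k t) (P + tmonop N c k)"
  shows "Q p P"
proof -
  obtain n c k where *: "p = tp n c k" "P = tpop N n c k" using assms by (auto simp: trig_def)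
  have "Q (tp n c k) (tpop N n c k)"
  proof (induction n)
    case 0
    then show ?case using assms(2) by (simp add: tp_def[abs_def] tpop_def)
  next
    case (Suc n)
    have "trig N (tp n c k) (tpop N n c k)" by (auto simp: trig_def)
    from assms(3)[OF this Suc, of "c n" "k n"] show ?case by (simp add: tp_def[abs_def] tpop_def)
  qed
  with * show ?thesis by simp
qed

lemma trig_mono: "trig N (tmono c k) (tmonop N c k)"
  using trig_add_mono[OF trig_0] by simp

lemma trig_add:
  assumes "trig N p P" "trig N q Q" shows "trig N (\<lambda>t. p t + q t) (P + Q)"
  using assms(2)
proof (induction rule: trig_induct)
  case (add q Q c k)
  from trig_add_mono[OF add(2)] show ?case by (simp add: add.assoc)
qed (use assms in simp)

lemma cscale_add: "cscale_op c (A + B) = cscale_op c A + cscale_op c B"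
  by (rule op_eqI) (simp add: algebra_simps)
lemma cscale_cscale: "cscale_op c (cscale_op d A) = cscale_op (c * d) A"
  by (rule op_eqI) (simp add: algebra_simps)

lemma trig_mult: 
  assumes "trig N p P" "trig N q Q" shows "trig N (\<lambda>t. p t * q t) (P o\<^sub>L Q)"
  using assms(1)
proof (induction rule: trig_induct)
  case 0
  then show ?case using trig_0 by simp
next
  case (add p P c k)
  have "trig N (\<lambda>t. tmono c k t * q t) (tmonop N c k o\<^sub>L Q)"
    using assms(2)
  proof (induction rule: trig_induct)
    case 0
    then show ?case using trig_0 by simp
  next
    case (add q Q c' k')
    have "tmonop N c k o\<^sub>L tmonop N c' k' = tmonop N (c * c') (k + k')"
      by (rule op_eqI) (simp add: algebra_simps)
    moreover have "(\<lambda>t. tmono c k t * tmono c' k' t) = tmono (c * c') (k + k')"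
      by (simp add: fun_eq_iff cis_mult algebra_simps flip: cis_mult)
    ultimately have "trig N (\<lambda>t. tmono c k t * tmono c' k' t) (tmonop N c k o\<^sub>L tmonop N c' k')"
      using trig_mono by metis
    from trig_add[OF add(2) this] show ?case
      by (simp add: distrib_left bounded_bilinear.add_right[OF bounded_bilinear_blinfun_compose])
  qed
  from trig_add[OF add(2) this] show ?case
    by (simp add: distrib_right bounded_bilinear.add_left[OF bounded_bilinear_blinfun_compose])
qed

lemma trig_adj:
  assumes "trig N p P" shows "\<exists>P'. trig N (\<lambda>t. cnj (p t)) P' \<and> is_adj P P'"
  using assms
proof (induction rule: trig_induct)
  case 0
  then show ?case using trig_0 is_adj_0 by auto
next
  case (add p P c k)
  then obtain P' where P': "trig N (\<lambda>t. cnj (p t)) P'" "is_adj P P'" by blast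
  have "is_adj (tmonop N c k) (shift_op (- (int N * k)) o\<^sub>L diag_op (\<lambda>_. cnj c))"
    unfolding cscale_op_def by (intro is_adj_comp is_adj_scalar is_adj_shift)
  also have "shift_op (- (int N * k)) o\<^sub>L diag_op (\<lambda>_. cnj c) = tmonop N (cnj c) (- k)"
    by (rule op_eqI) simp
  finally have "is_adj (P + tmonop N c k) (P' + tmonop N (cnj c) (- k))"
    by (rule is_adj_add[OF P'(2)])
  moreover have "trig N (\<lambda>t. cnj (p t + tmono c k t)) (P' + tmonop N (cnj c) (- k))"
    using trig_add_mono[OF P'(1), of "cnj c" "-k"] by (simp add: cis_cnj)
  ultimately show ?case by blast
qed

lemma trig_upper: "trig N p P \<Longrightarrow> (\<And>t. cmod (p t) \<le> m) \<Longrightarrow> norm P \<le> m"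
  by (auto simp: trig_def intro: tpop_upper)
lemma trig_lower: "trig N p P \<Longrightarrow> N > 0 \<Longrightarrow> cmod (p t) \<le> norm P"
  by (auto simp: trig_def intro: tpop_lower)

lemma C_circleI: "continuous_on UNIV f \<Longrightarrow> (\<And>t. f (t + 2 * pi) = f t) \<Longrightarrow> f \<in> C_circle"
  by (simp add: C_circle_def)

lemma C_circle_cis: "tmono c k \<in> C_circle"
proof (rule C_circleI)
  fix t
  have "cis (of_int k * (2 * pi)) = 1" by (rule cis_multiple_2pi[THEN trans[rotated]]) (auto simp: mult_ac)
  then show "tmono c k (t + 2 * pi) = tmono c k t" 
    unfolding distrib_left cis_mult[symmetric] by simp
qed (auto intro!: continuous_intros)
lemma C_circle_add: "f \<in> C_circle \<Longrightarrow> g \<in> C_circle \<Longrightarrow> (\<lambda>t. f t + g t) \<in> C_circle"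
  by (auto simp: C_circle_def intro: continuous_intros)
lemma C_circle_diff: "f \<in> C_circle \<Longrightarrow> g \<in> C_circle \<Longrightarrow> (\<lambda>t. f t - g t) \<in> C_circle"
  by (auto simp: C_circle_def intro: continuous_intros)
lemma C_circle_mult: "f \<in> C_circle \<Longrightarrow> g \<in> C_circle \<Longrightarrow> (\<lambda>t. f t * g t) \<in> C_circle"
  by (auto simp: C_circle_def intro: continuous_intros)
lemma C_circle_cnj: "f \<in> C_circle \<Longrightarrow> (\<lambda>t. cnj (f t)) \<in> C_circle"
  by (auto simp: C_circle_def intro: continuous_intros)
lemma C_circle_const: "(\<lambda>t. c) \<in> C_circle"
  by (auto simp: C_circle_def intro: continuous_intros)
lemma C_circle_sum: "(\<And>i. i \<in> I \<Longrightarrow> f i \<in> C_circle) \<Longrightarrow> (\<lambda>t. \<Sum>i\<in>I. f i t) \<in> C_circle"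
  by (induction I rule: infinite_finite_induct) (auto intro: C_circle_const C_circle_add)
lemma C_circle_trig: "trig N p P \<Longrightarrow> p \<in> C_circle"
  by (induction rule: trig_induct) (intro C_circle_const C_circle_add C_circle_cis)+

lemma trig_real_poly:
  assumes "real_polynomial_function q"
  shows "\<exists>P. trig N (\<lambda>t. of_real (q (cis t))) P"
  using assms
proof (induction rule: real_polynomial_function.induct)
  case (linear f)
  interpret f: bounded_linear f by fact
  have "f (cis t) = cos t * f 1 + sin t * f \<i>" for t
  proof -
    have "cis t = cos t *\<^sub>R 1 + sin t *\<^sub>R \<i>" by (simp add: complex_eq_iff)
    then show ?thesis by (simp add: f.add f.scaleR)
  qed
  then have e: "of_real (f (cis t)) = tmono ((f 1 - \<i> * f \<i>) / 2) 1 t + tmono ((f 1 + \<i> * f \<i>) / 2) (-1) t" for t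
    by (simp add: complex_eq_iff field_simps)
  show ?case unfolding e by (rule exI, rule trig_add, rule trig_mono, rule trig_mono)
next
  case (const c)
  then show ?case using trig_mono[of N "of_real c" 0] by auto
next
  case (add f g)
  then show ?case using trig_add by fastforce
next
  case (mult f g)
  then show ?case using trig_mult by fastforce
qed

lemma circle_fun_continuous:
  assumes f: "f \<in> C_circle"
  shows "continuous_on (sphere 0 1) (\<lambda>z. f (Arg z))" "f (Arg (cis t)) = f t"
proof -
  have cont: "isCont f t" for t using f by (simp add: C_circle_def continuous_on_eq_continuous_at)
  have per: "f (t + of_int k * (2 * pi)) = f t" for t k
  proof (induction k rule: int_induct[of _ 0])
    case (step1 i)
    have "f (t + of_int (i + 1) * (2 * pi)) = f ((t + of_int i * (2 * pi)) + 2 * pi)" by (simp add: algebra_simps)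
    also have "\<dots> = f (t + of_int i * (2 * pi))" using f by (simp only: C_circle_def mem_Collect_eq)
    finally show ?case using step1 by simp
  next
    case (step2 i)
    have "f (t + of_int i * (2 * pi)) = f ((t + of_int (i - 1) * (2 * pi)) + 2 * pi)" by (simp add: algebra_simps)
    also have "\<dots> = f (t + of_int (i - 1) * (2 * pi))" using f by (simp only: C_circle_def mem_Collect_eq)
    finally show ?case using step2 by simp
  qed simp
  have eq: "f s = f t" if "cis s = cis t" for s t
  proof -
    from that obtain k :: int where "s = t + of_int k * (2 * pi)"
      using sin_cos_eq_iff[of s t] by (auto simp: complex_eq_iff mult_ac)
    then show ?thesis using per by simp
  qed
  show "f (Arg (cis t)) = f t"
  proof (rule eq)
    have "cis t = of_real (cmod (cis t)) * exp (\<i> * of_real (Arg (cis t)))" by (rule Arg_eq) simp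
    then show "cis (Arg (cis t)) = cis t" by (simp add: cis_conv_exp)
  qed
  have A2: "f (Arg z) = f (Arg2pi z)" if "z \<noteq> 0" for z
  proof (rule eq)
    have "of_real (cmod z) * cis (Arg z) = z" "of_real (cmod z) * cis (Arg2pi z) = z"
      using Arg_eq[OF that] Arg2pi_eq[of z] by (auto simp: cis_conv_exp mult.commute)
    then have "of_real (cmod z) * cis (Arg z) = of_real (cmod z) * cis (Arg2pi z)" by (rule trans[OF _ sym])
    then show "cis (Arg z) = cis (Arg2pi z)" using that by simp
  qed
  show "continuous_on (sphere 0 1) (\<lambda>z. f (Arg z))"
  proof (rule continuous_at_imp_continuous_on, rule ballI)
    fix z :: complex assume z: "z \<in> sphere 0 1"
    show "isCont (\<lambda>z. f (Arg z)) z"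
    proof (cases "z \<in> \<real>\<^sub>\<le>\<^sub>0")
      case False
      then show ?thesis using continuous_at_Arg cont isCont_o2 by blast
    next
      case True
      with z have "z \<notin> \<real>\<^sub>\<ge>\<^sub>0" by (auto simp: complex_nonneg_Reals_iff complex_nonpos_Reals_iff cmod_def)
      then have "isCont (\<lambda>z. f (Arg2pi z)) z" using continuous_at_Arg2pi cont isCont_o2 by blast
      moreover have "\<forall>\<^sub>F w in nhds z. f (Arg w) = f (Arg2pi w)"
        using z by (intro eventually_mono[OF t1_space_nhds[of z 0]] A2) auto
      ultimately show ?thesis by (subst isCont_cong[where g = "\<lambda>z. f (Arg2pi z)"]) auto
    qed
  qed
qed

lemma trig_dense:
  assumes f: "f \<in> C_circle" and e: "e > 0"
  shows "\<exists>p P. trig N p P \<and> (\<forall>t. cmod (f t - p t) < e)"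
proof -
  obtain g where g: "polynomial_function g" "\<And>z. z \<in> sphere 0 1 \<Longrightarrow> cmod (f (Arg z) - g z) < e"
    using Stone_Weierstrass_polynomial_function[OF compact_sphere circle_fun_continuous(1)[OF f] e] by blast
  have "real_polynomial_function (\<lambda>z. Re (g z))" "real_polynomial_function (\<lambda>z. Im (g z))"
    using g(1)[unfolded polynomial_function_def, rule_format, OF bounded_linear_Re]
      g(1)[unfolded polynomial_function_def, rule_format, OF bounded_linear_Im] by (simp_all add: o_def)
  then obtain P Q where PQ: "trig N (\<lambda>t. of_real (Re (g (cis t)))) P" "trig N (\<lambda>t. of_real (Im (g (cis t)))) Q"
    using trig_real_poly[where N=N] by blast
  have "trig N (\<lambda>t. of_real (Re (g (cis t))) + tmono \<i> 0 t * of_real (Im (g (cis t)))) (P + (tmonop N \<i> 0 o\<^sub>L Q))"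
    by (intro trig_add trig_mult PQ trig_mono)
  also have "(\<lambda>t. of_real (Re (g (cis t))) + tmono \<i> 0 t * of_real (Im (g (cis t)))) = (\<lambda>t. g (cis t))"
    by (simp add: fun_eq_iff complex_eq_iff)
  finally have "trig N (\<lambda>t. g (cis t)) (P + (tmonop N \<i> 0 o\<^sub>L Q))" .
  moreover have "cmod (f t - g (cis t)) < e" for t
    using g(2)[of "cis t"] circle_fun_continuous(2)[OF f, of t] by simp
  ultimately show ?thesis by (intro exI conjI allI)
qed

definition fc :: "nat \<Rightarrow> (real \<Rightarrow> complex) \<Rightarrow> ell2_op \<Rightarrow> bool" where
  "fc N f A \<longleftrightarrow> (\<exists>p P. (\<forall>n. trig N (p n) (P n)) \<and> uniform_limit UNIV p f sequentially \<and> P \<longlonglongrightarrow> A)"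

lemma fc_trig: "trig N p P \<Longrightarrow> fc N p P"
  unfolding fc_def by (rule exI[of _ "\<lambda>_. p"], rule exI[of _ "\<lambda>_. P"]) (auto intro: uniform_limit_const)

lemma fc_lower:
  assumes "fc N f A" "N > 0" shows "cmod (f t) \<le> norm A"
proof -
  obtain p P where *: "\<And>n. trig N (p n) (P n)" "uniform_limit UNIV p f sequentially" "P \<longlonglongrightarrow> A"
    using assms by (auto simp: fc_def)
  show ?thesis
  proof (rule LIMSEQ_le)
    show "(\<lambda>n. cmod (p n t)) \<longlonglongrightarrow> cmod (f t)" using tendsto_uniform_limitI[OF *(2)] by (auto intro: tendsto_norm)
    show "(\<lambda>n. norm (P n)) \<longlonglongrightarrow> norm A" by (intro tendsto_norm *)
  qed (use trig_lower[OF *(1) assms(2)] in auto)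
qed

lemma fc_upper:
  assumes "fc N f A" "\<And>t. cmod (f t) \<le> m" shows "norm A \<le> m"
proof -
  obtain p P where *: "\<And>n. trig N (p n) (P n)" "uniform_limit UNIV p f sequentially" "P \<longlonglongrightarrow> A"
    using assms by (auto simp: fc_def)
  show ?thesis
  proof (rule field_le_epsilon)
    fix e :: real assume e: "e > 0"
    have "\<forall>\<^sub>F n in sequentially. norm (P n) \<le> m + e"
      using uniform_limitD[OF *(2) e]
    proof eventually_elim
      case (elim n)
      have "cmod (p n t) \<le> m + e" for t
      proof -
        have "cmod (p n t - f t) < e" using elim by (simp add: dist_norm)
        then show ?thesis using norm_triangle_ineq2[of "p n t" "f t"] assms(2)[of t] by linarith
      qed
      then show ?case by (rule trig_upper[OF *(1)])
    qed
    then show "norm A \<le> m + e"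
      by (rule tendsto_upperbound[OF tendsto_norm[OF *(3)]]) simp
  qed
qed

lemma fc_add:
  assumes "fc N f A" "fc N g B" shows "fc N (\<lambda>t. f t + g t) (A + B)"
proof -
  obtain p P where *: "\<And>n. trig N (p n) (P n)" "uniform_limit UNIV p f sequentially" "P \<longlonglongrightarrow> A"
    using assms by (auto simp: fc_def)
  obtain q Q where **: "\<And>n. trig N (q n) (Q n)" "uniform_limit UNIV q g sequentially" "Q \<longlonglongrightarrow> B"
    using assms by (auto simp: fc_def)
  show ?thesis unfolding fc_def
    by (rule exI[of _ "\<lambda>n t. p n t + q n t"], rule exI[of _ "\<lambda>n. P n + Q n"])
       (use trig_add[OF *(1) **(1)] uniform_limit_add[OF *(2) **(2)] tendsto_add[OF *(3) **(3)] in auto)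
qed

lemma fc_mult:
  assumes "fc N f A" "fc N g B" "N > 0" shows "fc N (\<lambda>t. f t * g t) (A o\<^sub>L B)"
proof -
  obtain p P where *: "\<And>n. trig N (p n) (P n)" "uniform_limit UNIV p f sequentially" "P \<longlonglongrightarrow> A"
    using assms by (auto simp: fc_def)
  obtain q Q where **: "\<And>n. trig N (q n) (Q n)" "uniform_limit UNIV q g sequentially" "Q \<longlonglongrightarrow> B"
    using assms by (auto simp: fc_def)
  have "bounded (range f)" "bounded (range g)"
    using fc_lower[OF assms(1,3)] fc_lower[OF assms(2,3)] by (auto simp: bounded_iff)
  then have u: "uniform_limit UNIV (\<lambda>n t. p n t * q n t) (\<lambda>t. f t * g t) sequentially"
    using uniform_lim_mult[OF *(2) **(2)] by blast
  show ?thesis unfolding fc_def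
    by (rule exI[of _ "\<lambda>n t. p n t * q n t"], rule exI[of _ "\<lambda>n. P n o\<^sub>L Q n"])
       (use trig_mult[OF *(1) **(1)] u bounded_bilinear.tendsto[OF bounded_bilinear_blinfun_compose *(3) **(3)] in auto)
qed

lemma cscale_id: "cscale_op c A = tmonop N c 0 o\<^sub>L A"
  by (rule op_eqI) simp

lemma fc_scale:
  assumes "fc N f A" "N > 0" shows "fc N (\<lambda>t. c * f t) (cscale_op c A)"
  using fc_mult[OF fc_trig[OF trig_mono[of N c 0]] assms] unfolding cscale_id[symmetric] by simp

lemma fc_diff:
  assumes "fc N f A" "fc N g B" "N > 0" shows "fc N (\<lambda>t. f t - g t) (A - B)"
proof -
  have "A + cscale_op (-1) B = A - B" by (rule op_eqI) simp
  then show ?thesis using fc_add[OF assms(1) fc_scale[OF assms(2,3), of "-1"]] by simp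
qed

lemma fc_unique: "fc N f A \<Longrightarrow> fc N f B \<Longrightarrow> N > 0 \<Longrightarrow> A = B"
  using fc_upper[OF fc_diff, of N f A f B 0] by simp

lemma fc_total:
  assumes f: "f \<in> C_circle" and N: "N > 0" shows "\<exists>A. fc N f A"
proof -
  have "\<exists>p P. trig N p P \<and> (\<forall>t. cmod (f t - p t) < 1 / Suc n)" for n
    by (rule trig_dense[OF f]) simp
  then obtain p P where t: "\<And>n. trig N (p n) (P n)" and l: "\<And>n t. cmod (f t - p n t) < 1 / Suc n" by metis
  have u: "uniform_limit UNIV p f sequentially"
  proof (rule uniform_limitI)
    fix e :: real assume e: "e > 0"
    show "\<forall>\<^sub>F n in sequentially. \<forall>t\<in>UNIV. dist (p n t) (f t) < e"
    proof -
      obtain M where M: "1 / Suc M < e" using e nat_approx_posE by blast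
      show ?thesis using eventually_ge_at_top[of M]
      proof eventually_elim
        case (elim n)
        then have "1 / real (Suc n) \<le> 1 / Suc M" by (simp add: frac_le)
        then show ?case using l[of _ n] M by (auto simp: dist_norm norm_minus_commute intro: less_trans less_le_trans)
      qed
    qed
  qed
  have "Cauchy P"
  proof (rule metric_CauchyI)
    fix e :: real assume e: "e > 0"
    obtain M where M: "\<And>n t. n \<ge> M \<Longrightarrow> cmod (p n t - f t) < e / 4"
      using uniform_limitD[OF u, of "e/4"] e by (auto simp: eventually_sequentially dist_norm)
    have "dist (P m) (P n) < e" if "m \<ge> M" "n \<ge> M" for m n
    proof -
      have "cmod (p m t - p n t) \<le> e / 2" for t
        using M[OF that(1), of t] M[OF that(2), of t] norm_triangle_ineq4[of "p m t - f t" "p n t - f t"] by simp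
      then have "norm (P m - P n) \<le> e / 2"
        using fc_upper[OF fc_diff[OF fc_trig[OF t] fc_trig[OF t] N]] by blast
      then show ?thesis using e by (simp add: dist_norm)
    qed
    then show "\<exists>M. \<forall>m\<ge>M. \<forall>n\<ge>M. dist (P m) (P n) < e" by blast
  qed
  then obtain A where "P \<longlonglongrightarrow> A" using Cauchy_convergent_iff convergent_def by blast
  with t u show ?thesis unfolding fc_def by blast
qed

lemma fc_adj:
  assumes "fc N f A" "N > 0" shows "\<exists>B. fc N (\<lambda>t. cnj (f t)) B \<and> is_adj A B"
proof -
  obtain p P where *: "\<And>n. trig N (p n) (P n)" "uniform_limit UNIV p f sequentially" "P \<longlonglongrightarrow> A"
    using assms by (auto simp: fc_def)
  obtain P' where P': "\<And>n. trig N (\<lambda>t. cnj (p n t)) (P' n)" "\<And>n. is_adj (P n) (P' n)"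
    using trig_adj[OF *(1)] by metis
  have u: "uniform_limit UNIV (\<lambda>n t. cnj (p n t)) (\<lambda>t. cnj (f t)) sequentially"
    using *(2) unfolding uniform_limit_iff dist_norm complex_cnj_diff[symmetric] complex_mod_cnj .
  have "Cauchy P'"
  proof (rule metric_CauchyI)
    fix e :: real assume e: "e > 0"
    obtain M where M: "\<And>n t. n \<ge> M \<Longrightarrow> cmod (cnj (p n t) - cnj (f t)) < e / 4"
      using uniform_limitD[OF u, of "e/4"] e by (auto simp: eventually_sequentially dist_norm)
    have "dist (P' m) (P' n) < e" if "m \<ge> M" "n \<ge> M" for m n
    proof -
      have "cmod (cnj (p m t) - cnj (p n t)) \<le> e / 2" for t
        using M[OF that(1), of t] M[OF that(2), of t] norm_triangle_ineq4[of "cnj (p m t) - cnj (f t)" "cnj (p n t) - cnj (f t)"] by simp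
      then have "norm (P' m - P' n) \<le> e / 2"
        using fc_upper[OF fc_diff[OF fc_trig[OF P'(1)] fc_trig[OF P'(1)] assms(2)]] by blast
      then show ?thesis using e by (simp add: dist_norm)
    qed
    then show "\<exists>M. \<forall>m\<ge>M. \<forall>n\<ge>M. dist (P' m) (P' n) < e" by blast
  qed
  then obtain B where B: "P' \<longlonglongrightarrow> B" using Cauchy_convergent_iff convergent_def by blast
  then have "is_adj A B" using is_adj_lim[OF P'(2) *(3)] by blast
  moreover have "fc N (\<lambda>t. cnj (f t)) B" unfolding fc_def
    by (rule exI[of _ "\<lambda>n t. cnj (p n t)"], rule exI[of _ P']) (use P'(1) u B in auto)
  ultimately show ?thesis by blast
qed

lemma comp_assoc_op: "(A o\<^sub>L B) o\<^sub>L C = A o\<^sub>L (B o\<^sub>L (C :: ell2_op))"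
  by (rule blinfun_eqI) simp

lemma fc_commute:
  assumes "fc N f A" and c: "\<And>k. shift_op (int N * k) o\<^sub>L B = B o\<^sub>L shift_op (int N * k)"
    and s: "\<And>c. diag_op (\<lambda>_. c) o\<^sub>L B = B o\<^sub>L diag_op (\<lambda>_. c)"
  shows "A o\<^sub>L B = B o\<^sub>L A"
proof -
  note bil = bounded_bilinear_blinfun_compose
  obtain p P where *: "\<And>n. trig N (p n) (P n)" "P \<longlonglongrightarrow> A"
    using assms by (auto simp: fc_def)
  have "P o\<^sub>L B = B o\<^sub>L P" if "trig N p P" for p P
    using that
  proof (induction rule: trig_induct)
    case (add p P c' k)
    have "tmonop N c' k o\<^sub>L B = B o\<^sub>L tmonop N c' k"
      unfolding cscale_op_def by (metis comp_assoc_op c s)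
    with add show ?case by (simp add: bounded_bilinear.add_left[OF bil] bounded_bilinear.add_right[OF bil])
  qed simp
  then have "P n o\<^sub>L B = B o\<^sub>L P n" for n using * by blast
  moreover have "(\<lambda>n. P n o\<^sub>L B) \<longlonglongrightarrow> (A o\<^sub>L B)" "(\<lambda>n. B o\<^sub>L P n) \<longlonglongrightarrow> (B o\<^sub>L A)"
    by (intro bounded_bilinear.tendsto[OF bil] tendsto_const *)+
  ultimately show ?thesis using LIMSEQ_unique by auto
qed

lemma fc_mem:
  assumes "fc N f A" "star_subalgebra S" "closed S" "\<And>k. shift_op (int N * k) \<in> S"
  shows "A \<in> S"
proof -
  obtain p P where *: "\<And>n. trig N (p n) (P n)" "P \<longlonglongrightarrow> A"
    using assms by (auto simp: fc_def)
  have "P \<in> S" if "trig N p P" for p P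
    using that
    by (induction rule: trig_induct) (use assms(2,4) in \<open>auto simp: star_subalgebra_def\<close>)
  then have "P n \<in> S" for n using *(1) by blast
  then show ?thesis by (rule closed_sequentially[OF assms(3) _ *(2)])
qed

lemma fc_closed:
  assumes fA: "\<And>n. fc N (f n) (A n)" "\<And>n. f n \<in> C_circle" "A \<longlonglongrightarrow> B" and N: "N > 0"
  shows "\<exists>g\<in>C_circle. fc N g B"
proof -
  have "uniformly_Cauchy_on UNIV f"
    unfolding uniformly_Cauchy_on_def
  proof (intro allI impI)
    fix e :: real assume "e > 0"
    then obtain M where M: "\<And>m n. m \<ge> M \<Longrightarrow> n \<ge> M \<Longrightarrow> dist (A m) (A n) < e"
      using LIMSEQ_imp_Cauchy[OF fA(3)] by (meson metric_CauchyD)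
    have "dist (f m t) (f n t) < e" if "m \<ge> M" "n \<ge> M" for m n t
      using fc_lower[OF fc_diff[OF fA(1) fA(1) N] N, of m t n] M[OF that] by (simp add: dist_norm)
    then show "\<exists>M. \<forall>x\<in>UNIV. \<forall>m\<ge>M. \<forall>n\<ge>M. dist (f m x) (f n x) < e" by blast
  qed
  then obtain g where g: "uniform_limit UNIV f g sequentially"
    using Cauchy_uniformly_convergent[of UNIV f] by (auto simp: uniformly_convergent_on_def)
  have gC: "g \<in> C_circle"
  proof (rule C_circleI)
    show "continuous_on UNIV g"
      by (rule uniform_limit_theorem[OF _ g]) (use fA(2) in \<open>auto simp: C_circle_def\<close>)
    fix t
    have L1: "(\<lambda>n. f n (t + 2 * pi)) \<longlonglongrightarrow> g (t + 2 * pi)" and L2: "(\<lambda>n. f n t) \<longlonglongrightarrow> g t"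
      using tendsto_uniform_limitI[OF g] by auto
    have "(\<lambda>n. f n (t + 2 * pi)) = (\<lambda>n. f n t)" using fA(2) by (simp add: C_circle_def)
    then show "g (t + 2 * pi) = g t" using LIMSEQ_unique[OF L1] L2 by simp
  qed
  then obtain B' where B': "fc N g B'" using fc_total[OF gC N] by blast
  have AB': "A \<longlonglongrightarrow> B'"
  proof (rule tendstoI)
    fix e :: real assume e: "e > 0"
    show "\<forall>\<^sub>F n in sequentially. dist (A n) B' < e"
      using uniform_limitD[OF g half_gt_zero[OF e]]
    proof eventually_elim
      case (elim n)
      have "norm (A n - B') \<le> e / 2"
      proof (rule fc_upper[OF fc_diff[OF fA(1) B' N]])
        fix t
        have "dist (f n t) (g t) < e / 2" using elim by blast
        then show "cmod (f n t - g t) \<le> e / 2" by (simp add: dist_norm)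
      qed
      then show ?case using e by (simp add: dist_norm)
    qed
  qed
  have BB: "B = B'"
    using tendsto_unique[OF sequentially_bot fA(3) AB'] .
  have "fc N g B" unfolding BB by (rule B')
  show ?thesis
  proof
    show "fc N g B" by fact
    show "g \<in> C_circle" by fact
  qed
qed

definition theta :: "nat \<Rightarrow> (real \<Rightarrow> complex) \<Rightarrow> ell2_op" where
  "theta N f = (SOME A. fc N f A)"

lemma fc_theta: "f \<in> C_circle \<Longrightarrow> N > 0 \<Longrightarrow> fc N f (theta N f)"
  unfolding theta_def by (rule someI_ex) (rule fc_total)

lemma theta_eqI: "fc N f A \<Longrightarrow> N > 0 \<Longrightarrow> theta N f = A"
  unfolding theta_def by (rule some_equality) (auto intro: fc_unique)

lemma theta_inj: 
  assumes "f \<in> C_circle" "g \<in> C_circle" "theta N f = theta N g" "N > 0"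
  shows "f = g"
proof
  fix t
  have "fc N (\<lambda>t. f t - g t) (theta N f - theta N g)"
    by (intro fc_diff fc_theta assms)
  from fc_lower[OF this assms(4), of t] assms(3) show "f t = g t" by simp
qed

lemma theta_add: "f \<in> C_circle \<Longrightarrow> g \<in> C_circle \<Longrightarrow> N > 0 \<Longrightarrow> theta N (\<lambda>t. f t + g t) = theta N f + theta N g"
  by (intro theta_eqI fc_add fc_theta)
lemma theta_mult: "f \<in> C_circle \<Longrightarrow> g \<in> C_circle \<Longrightarrow> N > 0 \<Longrightarrow> theta N (\<lambda>t. f t * g t) = theta N f o\<^sub>L theta N g"
  by (intro theta_eqI fc_mult fc_theta)
lemma theta_scale: "f \<in> C_circle \<Longrightarrow> N > 0 \<Longrightarrow> theta N (\<lambda>t. c * f t) = cscale_op c (theta N f)"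
  by (intro theta_eqI fc_scale fc_theta)
lemma theta_0: "N > 0 \<Longrightarrow> theta N (\<lambda>t. 0) = 0"
  by (intro theta_eqI fc_trig trig_0)
lemma theta_mono: "N > 0 \<Longrightarrow> theta N (tmono c k) = tmonop N c k"
  by (intro theta_eqI fc_trig trig_mono)
lemma theta_1: "N > 0 \<Longrightarrow> theta N (\<lambda>t. 1) = id_blinfun"
  using theta_mono[of N 1 0] by (simp add: shift_op_0 cscale_op_def) (rule op_eqI, simp)
lemma theta_sum: "N > 0 \<Longrightarrow> (\<And>i. i \<in> I \<Longrightarrow> f i \<in> C_circle) \<Longrightarrow> theta N (\<lambda>t. \<Sum>i\<in>I. f i t) = (\<Sum>i\<in>I. theta N (f i))"
  by (induction I rule: infinite_finite_induct) (auto simp: theta_0 theta_add C_circle_sum)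
lemma theta_adj:
  assumes "f \<in> C_circle" "N > 0"
  shows "is_adj (theta N f) (theta N (\<lambda>t. cnj (f t)))"
proof -
  obtain B where B: "fc N (\<lambda>t. cnj (f t)) B" "is_adj (theta N f) B"
    using fc_adj[OF fc_theta[OF assms] assms(2)] by blast
  from theta_eqI[OF B(1) assms(2)] B(2) show ?thesis by simp
qed

lemma cmod_eN: "cmod (if int N dvd l then 1 else 0) \<le> 1" by simp

lemma coord_P_op [simp]:
  "coord (P_op N s r x) l = (if int N dvd l - int s then coord x (l - int s + int r) else 0)"
  by (simp add: P_op_def coord_diag_op[OF cmod_eN] add.commute)

lemma dvd_small_iff: "s < N \<Longrightarrow> r < N \<Longrightarrow> int N dvd int s - int r \<longleftrightarrow> s = r"
  by (simp flip: mod_eq_dvd_iff)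

lemma P_mult:
  assumes "r < N" "s' < N"
  shows "P_op N s r o\<^sub>L P_op N s' r' = (if r = s' then P_op N s r' else 0)"
proof (rule op_eqI)
  fix x l
  have "int N dvd l - int s + int r - int s' \<longleftrightarrow> r = s'" if "int N dvd l - int s"
  proof -
    have e: "l - int s + int r - int s' = (l - int s) + (int r - int s')" by simp
    show ?thesis unfolding e dvd_add_right_iff[OF that] by (rule dvd_small_iff[OF assms])
  qed
  then show "coord ((P_op N s r o\<^sub>L P_op N s' r') x) l = coord ((if r = s' then P_op N s r' else 0) x) l"
    by auto
qed

lemma sum_residue:
  assumes "N > 0"
  shows "(\<Sum>s<N. if int N dvd l - int s then g s else 0) = (g (nat (l mod int N)) :: 'a :: comm_monoid_add)"
proof -
  have "int N dvd l - int s \<longleftrightarrow> s = nat (l mod int N)" if "s < N" for s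
  proof -
    have "int N dvd l - int s \<longleftrightarrow> l mod int N = int s"
      using that by (simp flip: mod_eq_dvd_iff)
    then show ?thesis using assms by (auto simp: nat_eq_iff2)
  qed
  then have "(\<Sum>s<N. if int N dvd l - int s then g s else 0) = (\<Sum>s<N. if s = nat (l mod int N) then g s else 0)"
    by (intro sum.cong) auto
  also have "\<dots> = g (nat (l mod int N))"
    using assms by (simp add: nat_less_iff)
  finally show ?thesis .
qed

lemma P_sum: "N > 0 \<Longrightarrow> (\<Sum>s<N. P_op N s s) = id_blinfun"
  by (rule op_eqI) (simp add: coord_blinfun_sum sum_residue)

lemma P_adj: "is_adj (P_op N s r) (P_op N r s)"
proof -
  let ?e = "\<lambda>l. if int N dvd l then 1 else 0 :: complex"
  have "(\<lambda>l. cnj (?e l)) = ?e" by auto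
  with is_adj_diag[of ?e 1] have d: "is_adj (diag_op ?e) (diag_op ?e)" by simp
  have "is_adj (P_op N s r) (shift_op (- (- int r)) o\<^sub>L (diag_op (\<lambda>l. if int N dvd l then 1 else 0) o\<^sub>L shift_op (- int s)))"
    unfolding P_op_def by (intro is_adj_comp is_adj_shift d)
  then show ?thesis unfolding P_op_def by (simp add: comp_assoc_op)
qed

lemma P_shift: "shift_op (int N * k) o\<^sub>L P_op N s r = P_op N s r o\<^sub>L shift_op (int N * k)"
proof (rule op_eqI)
  fix x l
  have "int N dvd l - int N * k - int s \<longleftrightarrow> int N dvd l - int s"
  proof -
    have "l - int N * k - int s = (l - int s) + int N * (- k)" by simp
    then show ?thesis by (simp only: dvd_add_left_iff[OF dvd_triv_left])
  qed
  then show "coord ((shift_op (int N * k) o\<^sub>L P_op N s r) x) l = coord ((P_op N s r o\<^sub>L shift_op (int N * k)) x) l"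
    by (simp add: algebra_simps)
qed

lemma P_scalar: "diag_op (\<lambda>_. c) o\<^sub>L P_op N s r = P_op N s r o\<^sub>L diag_op (\<lambda>_. c)"
  by (rule op_eqI) simp

lemma theta_P: "f \<in> C_circle \<Longrightarrow> N > 0 \<Longrightarrow> theta N f o\<^sub>L P_op N s r = P_op N s r o\<^sub>L theta N f"
  by (rule fc_commute[OF fc_theta P_shift P_scalar])

definition Psi :: "nat \<Rightarrow> (real \<Rightarrow> complex mat) \<Rightarrow> ell2_op" where
  "Psi N F = (\<Sum>s<N. \<Sum>r<N. theta N (\<lambda>t. F t $$ (s, r)) o\<^sub>L P_op N s r)"

lemmas comp_sum_left = bounded_bilinear.sum_left[OF bounded_bilinear_blinfun_compose]
lemmas comp_sum_right = bounded_bilinear.sum_right[OF bounded_bilinear_blinfun_compose]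
lemmas comp_add_left = bounded_bilinear.add_left[OF bounded_bilinear_blinfun_compose]
lemmas comp_add_right = bounded_bilinear.add_right[OF bounded_bilinear_blinfun_compose]

lemma C_matD: "F \<in> C_circle_mat N \<Longrightarrow> i < N \<Longrightarrow> j < N \<Longrightarrow> (\<lambda>t. F t $$ (i, j)) \<in> C_circle"
  "F \<in> C_circle_mat N \<Longrightarrow> F t \<in> carrier_mat N N"
  by (auto simp: C_circle_mat_def)

lemma Psi_add:
  assumes "F \<in> C_circle_mat N" "G \<in> C_circle_mat N" "N > 0"
  shows "Psi N (\<lambda>t. F t + G t) = Psi N F + Psi N G"
proof -
  have *: "theta N (\<lambda>t. (F t + G t) $$ (s, r)) = theta N (\<lambda>t. F t $$ (s, r)) + theta N (\<lambda>t. G t $$ (s, r))"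
    if "s < N" "r < N" for s r
  proof -
    have e: "(\<lambda>t. (F t + G t) $$ (s, r)) = (\<lambda>t. F t $$ (s, r) + G t $$ (s, r))"
    proof
      fix t
      show "(F t + G t) $$ (s, r) = F t $$ (s, r) + G t $$ (s, r)"
        using C_matD(2)[OF assms(2), of t] that by simp
    qed
    show ?thesis unfolding e by (rule theta_add[OF C_matD(1)[OF assms(1) that] C_matD(1)[OF assms(2) that] assms(3)])
  qed
  have "Psi N (\<lambda>t. F t + G t) = (\<Sum>s<N. \<Sum>r<N. (theta N (\<lambda>t. F t $$ (s, r)) o\<^sub>L P_op N s r) + (theta N (\<lambda>t. G t $$ (s, r)) o\<^sub>L P_op N s r))"
    unfolding Psi_def
    by (rule sum.cong[OF refl], rule sum.cong[OF refl], subst *) (simp_all only: lessThan_iff comp_add_left)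
  then show ?thesis unfolding sum.distrib Psi_def .
qed

lemma Psi_scale:
  assumes "F \<in> C_circle_mat N" "N > 0"
  shows "Psi N (\<lambda>t. c \<cdot>\<^sub>m F t) = cscale_op c (Psi N F)"
proof -
  have *: "theta N (\<lambda>t. (c \<cdot>\<^sub>m F t) $$ (s, r)) = cscale_op c (theta N (\<lambda>t. F t $$ (s, r)))"
    if "s < N" "r < N" for s r
  proof -
    have e: "(\<lambda>t. (c \<cdot>\<^sub>m F t) $$ (s, r)) = (\<lambda>t. c * F t $$ (s, r))"
    proof
      fix t
      show "(c \<cdot>\<^sub>m F t) $$ (s, r) = c * F t $$ (s, r)"
        using C_matD(2)[OF assms(1), of t] that by simp
    qed
    show ?thesis unfolding e by (rule theta_scale[OF C_matD(1)[OF assms(1) that] assms(2)])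
  qed
  have "Psi N (\<lambda>t. c \<cdot>\<^sub>m F t) = (\<Sum>s<N. \<Sum>r<N. diag_op (\<lambda>_. c) o\<^sub>L (theta N (\<lambda>t. F t $$ (s, r)) o\<^sub>L P_op N s r))"
    unfolding Psi_def
    by (rule sum.cong[OF refl], rule sum.cong[OF refl], subst *) (simp_all only: lessThan_iff cscale_op_def comp_assoc_op)
  then show ?thesis unfolding cscale_op_def comp_sum_right[symmetric] Psi_def .
qed

lemma Psi_mult:
  assumes F: "F \<in> C_circle_mat N" and G: "G \<in> C_circle_mat N" and N: "N > 0"
  shows "Psi N (\<lambda>t. F t * G t) = Psi N F o\<^sub>L Psi N G"
proof -
  let ?f = "\<lambda>s r. theta N (\<lambda>t. F t $$ (s, r))" and ?g = "\<lambda>s r. theta N (\<lambda>t. G t $$ (s, r))"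
  have th: "theta N (\<lambda>t. (F t * G t) $$ (s, r)) = (\<Sum>k<N. ?f s k o\<^sub>L ?g k r)" if "s < N" "r < N" for s r
  proof -
    have e: "(\<lambda>t. (F t * G t) $$ (s, r)) = (\<lambda>t. \<Sum>k<N. F t $$ (s, k) * G t $$ (k, r))"
    proof
      fix t
      have c: "dim_row (F t) = N" "dim_col (F t) = N" "dim_row (G t) = N" "dim_col (G t) = N"
        using C_matD(2)[OF F, of t] C_matD(2)[OF G, of t] by auto
      have "(F t * G t) $$ (s, r) = Matrix.row (F t) s \<bullet> Matrix.col (G t) r"
        using that c by simp
      also have "\<dots> = (\<Sum>k<N. F t $$ (s, k) * G t $$ (k, r))"
        unfolding scalar_prod_def using that c by (auto simp: lessThan_atLeast0 intro!: sum.cong)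
      finally show "(F t * G t) $$ (s, r) = (\<Sum>k<N. F t $$ (s, k) * G t $$ (k, r))" .
    qed
    have "theta N (\<lambda>t. \<Sum>k<N. F t $$ (s, k) * G t $$ (k, r)) = (\<Sum>k<N. theta N (\<lambda>t. F t $$ (s, k) * G t $$ (k, r)))"
      by (rule theta_sum[OF N]) (use that in \<open>auto intro: C_circle_mult C_matD(1)[OF F] C_matD(1)[OF G]\<close>)
    also have "\<dots> = (\<Sum>k<N. ?f s k o\<^sub>L ?g k r)"
      by (rule sum.cong[OF refl], rule theta_mult) (use that N in \<open>auto intro: C_matD(1)[OF F] C_matD(1)[OF G]\<close>)
    finally show ?thesis unfolding e .
  qed
  have pr: "(?f s k o\<^sub>L P_op N s k) o\<^sub>L (?g k' r o\<^sub>L P_op N k' r) = (if k = k' then (?f s k o\<^sub>L ?g k r) o\<^sub>L P_op N s r else 0)"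
    if "s < N" "r < N" "k < N" "k' < N" for s r k k'
  proof -
    have "(?f s k o\<^sub>L P_op N s k) o\<^sub>L (?g k' r o\<^sub>L P_op N k' r) = ?f s k o\<^sub>L ((P_op N s k o\<^sub>L ?g k' r) o\<^sub>L P_op N k' r)"
      by (simp only: comp_assoc_op)
    also have "P_op N s k o\<^sub>L ?g k' r = ?g k' r o\<^sub>L P_op N s k"
      by (rule theta_P[OF C_matD(1)[OF G] N, symmetric]) (use that in auto)
    also have "?f s k o\<^sub>L ((?g k' r o\<^sub>L P_op N s k) o\<^sub>L P_op N k' r) = (?f s k o\<^sub>L ?g k' r) o\<^sub>L (P_op N s k o\<^sub>L P_op N k' r)"
      by (simp only: comp_assoc_op)
    finally show ?thesis using that by (simp add: P_mult)
  qed
  have "Psi N F o\<^sub>L Psi N G = (\<Sum>s<N. \<Sum>k<N. \<Sum>k'<N. \<Sum>r<N. (?f s k o\<^sub>L P_op N s k) o\<^sub>L (?g k' r o\<^sub>L P_op N k' r))"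
  proof -
    have "Psi N F o\<^sub>L Psi N G = (\<Sum>s<N. \<Sum>k<N. (?f s k o\<^sub>L P_op N s k) o\<^sub>L Psi N G)"
      by (simp only: Psi_def[of N F] comp_sum_left)
    also have "\<dots> = (\<Sum>s<N. \<Sum>k<N. \<Sum>k'<N. \<Sum>r<N. (?f s k o\<^sub>L P_op N s k) o\<^sub>L (?g k' r o\<^sub>L P_op N k' r))"
      by (simp only: Psi_def comp_sum_right)
    finally show ?thesis .
  qed
  also have "\<dots> = (\<Sum>s<N. \<Sum>k<N. \<Sum>k'<N. \<Sum>r<N. (if k = k' then (?f s k o\<^sub>L ?g k r) o\<^sub>L P_op N s r else 0))"
    by (intro sum.cong refl pr) auto
  also have "\<dots> = (\<Sum>s<N. \<Sum>k<N. \<Sum>r<N. (?f s k o\<^sub>L ?g k r) o\<^sub>L P_op N s r)"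
  proof (rule sum.cong[OF refl], rule sum.cong[OF refl])
    fix s k assume "k \<in> {..<N}"
    have "(\<Sum>k'<N. \<Sum>r<N. (if k = k' then (?f s k o\<^sub>L ?g k r) o\<^sub>L P_op N s r else 0))
       = (\<Sum>k'<N. if k = k' then \<Sum>r<N. (?f s k o\<^sub>L ?g k r) o\<^sub>L P_op N s r else 0)"
      by (intro sum.cong) auto
    then show "(\<Sum>k'<N. \<Sum>r<N. (if k = k' then (?f s k o\<^sub>L ?g k r) o\<^sub>L P_op N s r else 0)) = (\<Sum>r<N. (?f s k o\<^sub>L ?g k r) o\<^sub>L P_op N s r)"
      using \<open>k \<in> _\<close> by simp
  qed
  also have "\<dots> = (\<Sum>s<N. \<Sum>r<N. \<Sum>k<N. (?f s k o\<^sub>L ?g k r) o\<^sub>L P_op N s r)"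
    by (intro sum.cong refl sum.swap)
  also have "\<dots> = Psi N (\<lambda>t. F t * G t)"
    unfolding Psi_def by (intro sum.cong refl) (simp add: th comp_sum_left)
  finally show ?thesis ..
qed

lemma mat_adjoint_index:
  assumes "A \<in> carrier_mat N N" "i < N" "j < N"
  shows "mat_adjoint A $$ (i, j) = cnj (A $$ (j, i))"
  using assms by (simp add: mat_adjoint_def mat_of_rows_index)

lemma mat_adjoint_carrier: "A \<in> carrier_mat N N \<Longrightarrow> mat_adjoint (A :: complex mat) \<in> carrier_mat N N"
  by (intro carrier_matI) (auto simp: mat_adjoint_def mat_of_rows_def)

lemma Psi_adj:
  assumes F: "F \<in> C_circle_mat N" and N: "N > 0"
  shows "is_adj (Psi N F) (Psi N (\<lambda>t. mat_adjoint (F t)))"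
proof -
  have "is_adj (Psi N F) (\<Sum>s<N. \<Sum>r<N. P_op N r s o\<^sub>L theta N (\<lambda>t. cnj (F t $$ (s, r))))"
    unfolding Psi_def using F N by (intro is_adj_sum is_adj_comp theta_adj P_adj) (auto intro: C_matD)
  also have "(\<Sum>s<N. \<Sum>r<N. P_op N r s o\<^sub>L theta N (\<lambda>t. cnj (F t $$ (s, r)))) = 
     (\<Sum>s<N. \<Sum>r<N. theta N (\<lambda>t. mat_adjoint (F t) $$ (r, s)) o\<^sub>L P_op N r s)"
    using F N by (intro sum.cong refl) (simp add: mat_adjoint_index[OF C_matD(2)[OF F]] theta_P C_circle_cnj C_matD)
  also have "\<dots> = Psi N (\<lambda>t. mat_adjoint (F t))"
    unfolding Psi_def by (rule sum.swap)
  finally show ?thesis .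
qed

lemma Psi_recover:
  assumes F: "F \<in> C_circle_mat N" and N: "N > 0" and s: "s < N" and r: "r < N"
  shows "(\<Sum>k<N. (P_op N k s o\<^sub>L Psi N F) o\<^sub>L P_op N r k) = theta N (\<lambda>t. F t $$ (s, r))"
proof -
  let ?f = "\<lambda>s r. theta N (\<lambda>t. F t $$ (s, r))"
  have "(P_op N k s o\<^sub>L Psi N F) o\<^sub>L P_op N r k = ?f s r o\<^sub>L P_op N k k" if k: "k < N" for k
  proof -
    have "(P_op N k s o\<^sub>L Psi N F) o\<^sub>L P_op N r k = (\<Sum>a<N. \<Sum>b<N. P_op N k s o\<^sub>L (?f a b o\<^sub>L P_op N a b) o\<^sub>L P_op N r k)"
      unfolding Psi_def comp_sum_left comp_sum_right ..
    also have "\<dots> = (\<Sum>a<N. \<Sum>b<N. if a = s then if b = r then ?f s r o\<^sub>L P_op N k k else 0 else 0)"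
    proof (intro sum.cong refl)
      fix a b assume ab: "a \<in> {..<N}" "b \<in> {..<N}"
      have "P_op N k s o\<^sub>L (?f a b o\<^sub>L P_op N a b) o\<^sub>L P_op N r k = (P_op N k s o\<^sub>L ?f a b) o\<^sub>L (P_op N a b o\<^sub>L P_op N r k)"
        by (simp only: comp_assoc_op)
      also have "P_op N k s o\<^sub>L ?f a b = ?f a b o\<^sub>L P_op N k s"
        by (rule theta_P[OF C_matD(1)[OF F] N, symmetric]) (use ab in auto)
      also have "(?f a b o\<^sub>L P_op N k s) o\<^sub>L (P_op N a b o\<^sub>L P_op N r k) = ?f a b o\<^sub>L ((P_op N k s o\<^sub>L P_op N a b) o\<^sub>L P_op N r k)"
        by (simp only: comp_assoc_op)
      finally show "P_op N k s o\<^sub>L (?f a b o\<^sub>L P_op N a b) o\<^sub>L P_op N r k = (if a = s then if b = r then ?f s r o\<^sub>L P_op N k k else 0 else 0)"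
        using ab s r by (auto simp: P_mult)
    qed
    also have "\<dots> = ?f s r o\<^sub>L P_op N k k"
    proof -
      have "(\<Sum>b<N. if a = s then if b = r then ?f s r o\<^sub>L P_op N k k else 0 else 0) = (if a = s then ?f s r o\<^sub>L P_op N k k else 0)" for a
        using r by auto
      then show ?thesis using s by simp
    qed
    finally show ?thesis .
  qed
  then have "(\<Sum>k<N. (P_op N k s o\<^sub>L Psi N F) o\<^sub>L P_op N r k) = ?f s r o\<^sub>L (\<Sum>k<N. P_op N k k)"
    by (simp add: comp_sum_right)
  then show ?thesis by (simp add: P_sum[OF N]) (rule op_eqI, simp)
qed

lemma Psi_inj: "N > 0 \<Longrightarrow> inj_on (Psi N) (C_circle_mat N)"
proof (rule inj_onI, rule ext)
  fix F G t assume N: "N > 0" and F: "F \<in> C_circle_mat N" and G: "G \<in> C_circle_mat N" and e: "Psi N F = Psi N G"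
  have "F t $$ (s, r) = G t $$ (s, r)" if "s < N" "r < N" for s r
  proof -
    have "theta N (\<lambda>t. F t $$ (s, r)) = theta N (\<lambda>t. G t $$ (s, r))"
      unfolding Psi_recover[OF F N that, symmetric] Psi_recover[OF G N that, symmetric] e ..
    from theta_inj[OF C_matD(1)[OF F that] C_matD(1)[OF G that] this N] show ?thesis by (rule fun_cong)
  qed
  then show "F t = G t"
    using C_matD(2)[OF F, of t] C_matD(2)[OF G, of t] by (intro eq_matI) auto
qed

lemma C_mat_intro:
  assumes "\<And>i j. i < N \<Longrightarrow> j < N \<Longrightarrow> f i j \<in> C_circle"
  shows "(\<lambda>t. Matrix.mat N N (\<lambda>(i, j). f i j t)) \<in> C_circle_mat N"
  using assms by (auto simp: C_circle_mat_def)

lemma C_mat_single: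
  assumes f: "f \<in> C_circle" and N: "N > 0" "s < N" "r < N"
  shows "(\<lambda>t. f t \<cdot>\<^sub>m mat_unit N s r) \<in> C_circle_mat N"
    "Psi N (\<lambda>t. f t \<cdot>\<^sub>m mat_unit N s r) = theta N f o\<^sub>L P_op N s r"
proof -
  have e: "(\<lambda>t. (f t \<cdot>\<^sub>m mat_unit N s r) $$ (a, b)) = (if a = s \<and> b = r then f else (\<lambda>t. 0))" if "a < N" "b < N" for a b
    using that by (simp add: mat_unit_def fun_eq_iff)
  show "(\<lambda>t. f t \<cdot>\<^sub>m mat_unit N s r) \<in> C_circle_mat N"
    unfolding C_circle_mat_def
  proof (intro CollectI conjI allI impI)
    show "(\<lambda>t. (f t \<cdot>\<^sub>m mat_unit N s r) $$ (a, b)) \<in> C_circle" if "a < N" "b < N" for a b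
      unfolding e[OF that] using f C_circle_const[of 0] by (cases "a = s \<and> b = r") simp_all
  qed (simp add: mat_unit_def)
  have "Psi N (\<lambda>t. f t \<cdot>\<^sub>m mat_unit N s r) = (\<Sum>a<N. \<Sum>b<N. if a = s then if b = r then theta N f o\<^sub>L P_op N s r else 0 else 0)"
    unfolding Psi_def
  proof (rule sum.cong[OF refl], rule sum.cong[OF refl])
    fix a b assume ab: "a \<in> {..<N}" "b \<in> {..<N}"
    then have e': "(\<lambda>t. (f t \<cdot>\<^sub>m mat_unit N s r) $$ (a, b)) = (if a = s \<and> b = r then f else (\<lambda>t. 0))"
      by (intro e) auto
    show "theta N (\<lambda>t. (f t \<cdot>\<^sub>m mat_unit N s r) $$ (a, b)) o\<^sub>L P_op N a b =
        (if a = s then if b = r then theta N f o\<^sub>L P_op N s r else 0 else 0)"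
      unfolding e' by (cases "a = s"; cases "b = r"; simp add: theta_0[OF N(1)])
  qed
  also have "\<dots> = (\<Sum>a<N. if a = s then theta N f o\<^sub>L P_op N s r else 0)"
    using N by (intro sum.cong refl) auto
  finally show "Psi N (\<lambda>t. f t \<cdot>\<^sub>m mat_unit N s r) = theta N f o\<^sub>L P_op N s r" using N by simp
qed

lemma C_mat_diag:
  assumes f: "f \<in> C_circle" and N: "N > 0"
  shows "(\<lambda>t. f t \<cdot>\<^sub>m 1\<^sub>m N) \<in> C_circle_mat N" "Psi N (\<lambda>t. f t \<cdot>\<^sub>m 1\<^sub>m N) = theta N f"
proof -
  have e: "(\<lambda>t. (f t \<cdot>\<^sub>m 1\<^sub>m N) $$ (a, b)) = (if a = b then f else (\<lambda>t. 0))" if "a < N" "b < N" for a b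
    using that by (simp add: fun_eq_iff)
  show "(\<lambda>t. f t \<cdot>\<^sub>m 1\<^sub>m N) \<in> C_circle_mat N"
    unfolding C_circle_mat_def
  proof (intro CollectI conjI allI impI)
    show "(\<lambda>t. (f t \<cdot>\<^sub>m 1\<^sub>m N) $$ (a, b)) \<in> C_circle" if "a < N" "b < N" for a b
      unfolding e[OF that] using f C_circle_const[of 0] by (cases "a = b") simp_all
  qed simp
  have "Psi N (\<lambda>t. f t \<cdot>\<^sub>m 1\<^sub>m N) = (\<Sum>a<N. \<Sum>b<N. if a = b then theta N f o\<^sub>L P_op N a a else 0)"
    unfolding Psi_def
  proof (rule sum.cong[OF refl], rule sum.cong[OF refl])
    fix a b assume ab: "a \<in> {..<N}" "b \<in> {..<N}"
    then have e': "(\<lambda>t. (f t \<cdot>\<^sub>m 1\<^sub>m N) $$ (a, b)) = (if a = b then f else (\<lambda>t. 0))"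
      by (intro e) auto
    show "theta N (\<lambda>t. (f t \<cdot>\<^sub>m 1\<^sub>m N) $$ (a, b)) o\<^sub>L P_op N a b = (if a = b then theta N f o\<^sub>L P_op N a a else 0)"
      unfolding e' by (cases "a = b"; simp add: theta_0[OF N(1)])
  qed
  also have "\<dots> = theta N f o\<^sub>L (\<Sum>a<N. P_op N a a)"
    by (simp add: comp_sum_right)
  finally show "Psi N (\<lambda>t. f t \<cdot>\<^sub>m 1\<^sub>m N) = theta N f" by (simp add: P_sum[OF N]) (rule op_eqI, simp)
qed

definition psi_range :: "nat \<Rightarrow> ell2_op set" where "psi_range N = Psi N ` C_circle_mat N"

lemma C_mat_ops:
  assumes F: "F \<in> C_circle_mat N"
  shows "G \<in> C_circle_mat N \<Longrightarrow> (\<lambda>t. F t + G t) \<in> C_circle_mat N"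
    "G \<in> C_circle_mat N \<Longrightarrow> (\<lambda>t. F t * G t) \<in> C_circle_mat N"
    "(\<lambda>t. c \<cdot>\<^sub>m F t) \<in> C_circle_mat N"
    "(\<lambda>t. mat_adjoint (F t)) \<in> C_circle_mat N"
proof -
  note cF = C_matD(2)[OF F]
  show "(\<lambda>t. c \<cdot>\<^sub>m F t) \<in> C_circle_mat N"
  proof -
    have "(\<lambda>t. (c \<cdot>\<^sub>m F t) $$ (i, j)) = (\<lambda>t. c * F t $$ (i, j))" if "i < N" "j < N" for i j
    proof
      fix t
      show "(c \<cdot>\<^sub>m F t) $$ (i, j) = c * F t $$ (i, j)" using cF[of t] that by simp
    qed
    then show ?thesis unfolding C_circle_mat_def
      by (intro CollectI conjI allI impI) (simp_all only: smult_carrier_mat cF C_circle_mult C_circle_const C_matD(1)[OF F])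
  qed
  show "(\<lambda>t. mat_adjoint (F t)) \<in> C_circle_mat N"
    unfolding C_circle_mat_def
    by (intro CollectI conjI allI impI)
       (simp_all only: mat_adjoint_carrier cF mat_adjoint_index[OF cF] C_circle_cnj C_matD(1)[OF F])
  assume G: "G \<in> C_circle_mat N"
  note cG = C_matD(2)[OF G]
  show "(\<lambda>t. F t + G t) \<in> C_circle_mat N"
  proof -
    have "(\<lambda>t. (F t + G t) $$ (i, j)) = (\<lambda>t. F t $$ (i, j) + G t $$ (i, j))" if "i < N" "j < N" for i j
    proof
      fix t
      show "(F t + G t) $$ (i, j) = F t $$ (i, j) + G t $$ (i, j)" using cG[of t] that by simp
    qed
    then show ?thesis unfolding C_circle_mat_def
      by (intro CollectI conjI allI impI) (simp_all only: add_carrier_mat cF cG C_circle_add C_matD(1)[OF F] C_matD(1)[OF G])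
  qed
  show "(\<lambda>t. F t * G t) \<in> C_circle_mat N"
  proof -
    have "(\<lambda>t. (F t * G t) $$ (i, j)) = (\<lambda>t. \<Sum>k<N. F t $$ (i, k) * G t $$ (k, j))" if "i < N" "j < N" for i j
    proof
      fix t
      have c: "dim_row (F t) = N" "dim_col (F t) = N" "dim_row (G t) = N" "dim_col (G t) = N"
        using cF[of t] cG[of t] by auto
      have "(F t * G t) $$ (i, j) = Matrix.row (F t) i \<bullet> Matrix.col (G t) j"
        using that c by simp
      also have "\<dots> = (\<Sum>k<N. F t $$ (i, k) * G t $$ (k, j))"
        unfolding scalar_prod_def using that c by (auto simp: lessThan_atLeast0 intro!: sum.cong)
      finally show "(F t * G t) $$ (i, j) = (\<Sum>k<N. F t $$ (i, k) * G t $$ (k, j))" .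
    qed
    moreover have "(\<lambda>t. \<Sum>k<N. F t $$ (i, k) * G t $$ (k, j)) \<in> C_circle" if "i < N" "j < N" for i j
      by (rule C_circle_sum, rule C_circle_mult) (use that in \<open>auto intro: C_matD(1)[OF F] C_matD(1)[OF G]\<close>)
    ultimately show ?thesis unfolding C_circle_mat_def
      by (intro CollectI conjI allI impI) (simp_all only: mult_carrier_mat[OF cF cG])
  qed
qed

lemma R_star: 
  assumes N: "N > 0" shows "star_subalgebra (psi_range N)"
  unfolding star_subalgebra_def
proof (intro conjI ballI allI)
  show "0 \<in> psi_range N" unfolding psi_range_def
    by (rule image_eqI[OF _ C_mat_diag(1)[OF C_circle_const[of 0] N]])
       (simp only: C_mat_diag(2)[OF C_circle_const[of 0] N] theta_0[OF N])
  fix A assume "A \<in> psi_range N"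
  then obtain F where F: "F \<in> C_circle_mat N" "A = Psi N F" by (auto simp: psi_range_def)
  show "cscale_op c A \<in> psi_range N" for c
    unfolding psi_range_def F Psi_scale[OF F(1) N, symmetric] by (intro imageI C_mat_ops F)
  show "op_adjoint A \<in> psi_range N"
    unfolding psi_range_def F op_adjoint_eqI[OF Psi_adj[OF F(1) N]] by (intro imageI C_mat_ops F)
  fix B assume "B \<in> psi_range N"
  then obtain G where G: "G \<in> C_circle_mat N" "B = Psi N G" by (auto simp: psi_range_def)
  show "A + B \<in> psi_range N"
    unfolding psi_range_def F G Psi_add[OF F(1) G(1) N, symmetric] by (intro imageI C_mat_ops F G)
  show "A o\<^sub>L B \<in> psi_range N"
    unfolding psi_range_def F G Psi_mult[OF F(1) G(1) N, symmetric] by (intro imageI C_mat_ops F G)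
qed

lemma R_theta:
  assumes "f \<in> C_circle" "N > 0" shows "theta N f \<in> psi_range N"
  unfolding psi_range_def C_mat_diag(2)[OF assms, symmetric] by (rule imageI[OF C_mat_diag(1)[OF assms]])

lemma R_P: 
  assumes "N > 0" "s < N" "r < N" shows "P_op N s r \<in> psi_range N"
proof -
  have "P_op N s r = theta N (\<lambda>t. 1) o\<^sub>L P_op N s r"
    unfolding theta_1[OF assms(1)] by (rule op_eqI) simp
  also have "\<dots> \<in> psi_range N"
    unfolding psi_range_def C_mat_single(2)[OF C_circle_const[of 1] assms, symmetric]
    by (rule imageI[OF C_mat_single(1)[OF C_circle_const[of 1] assms]])
  finally show ?thesis .
qed

lemma star_sum: "star_subalgebra S \<Longrightarrow> (\<And>i. i \<in> I \<Longrightarrow> A i \<in> S) \<Longrightarrow> (\<Sum>i\<in>I. A i) \<in> S"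
  by (induction I rule: infinite_finite_induct) (auto simp: star_subalgebra_def)

lemma R_closed: 
  assumes N: "N > 0" shows "closed (psi_range N)"
  unfolding closed_sequential_limits
proof (intro allI impI, elim conjE)
  fix X A assume X: "\<forall>n. X n \<in> psi_range N" and A: "X \<longlonglongrightarrow> A"
  then obtain F where F: "\<And>n. F n \<in> C_circle_mat N" "\<And>n. X n = Psi N (F n)"
    unfolding psi_range_def image_iff by metis
  define B where "B s r = (\<Sum>k<N. (P_op N k s o\<^sub>L A) o\<^sub>L P_op N r k)" for s r
  have lim: "(\<lambda>n. theta N (\<lambda>t. F n t $$ (s, r))) \<longlonglongrightarrow> B s r" if "s < N" "r < N" for s r
  proof -
    have "(\<lambda>n. \<Sum>k<N. (P_op N k s o\<^sub>L X n) o\<^sub>L P_op N r k) \<longlonglongrightarrow> B s r"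
      unfolding B_def by (intro tendsto_sum bounded_bilinear.tendsto[OF bounded_bilinear_blinfun_compose] tendsto_const A)
    then show ?thesis by (simp add: F(2) Psi_recover[OF F(1) N that])
  qed
  have "\<exists>g\<in>C_circle. fc N g (B s r)" if "s < N" "r < N" for s r
    by (rule fc_closed[OF fc_theta[OF C_matD(1)[OF F(1) that] N] C_matD(1)[OF F(1) that] lim[OF that] N])
  then obtain g where g: "\<And>s r. s < N \<Longrightarrow> r < N \<Longrightarrow> g s r \<in> C_circle \<and> fc N (g s r) (B s r)" by metis
  define G where "G t = Matrix.mat N N (\<lambda>(i, j). g i j t)" for t
  have G: "G \<in> C_circle_mat N" unfolding G_def by (rule C_mat_intro) (use g in auto)
  have "Psi N G = (\<Sum>s<N. \<Sum>r<N. B s r o\<^sub>L P_op N s r)"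
    unfolding Psi_def G_def using g N by (intro sum.cong refl) (auto intro!: arg_cong2[of _ _ _ _ "(o\<^sub>L)"] theta_eqI)
  moreover have "X \<longlonglongrightarrow> (\<Sum>s<N. \<Sum>r<N. B s r o\<^sub>L P_op N s r)"
    unfolding F(2) Psi_def 
    by (intro tendsto_sum bounded_bilinear.tendsto[OF bounded_bilinear_blinfun_compose] tendsto_const lim) auto
  ultimately have "A = Psi N G" using LIMSEQ_unique[OF A] by simp
  then show "A \<in> psi_range N" using G by (simp add: psi_range_def)
qed

lemma dvd_period:
  fixes b :: "int \<Rightarrow> 'a"
  assumes "j dvd N" "\<And>l. b (l + int j) = b l"
  shows "b (l mod int N) = b l"
proof -
  have p: "b (l + int j * k) = b l" for l k
  proof (induction k rule: int_induct[of _ 0])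
    case (step1 i)
    have "b (l + int j * (i + 1)) = b ((l + int j * i) + int j)" by (simp add: algebra_simps)
    then show ?case using step1 assms(2) by simp
  next
    case (step2 i)
    have "b (l + int j * i) = b ((l + int j * (i - 1)) + int j)" by (simp add: algebra_simps)
    then show ?case using step2 assms(2) by simp
  qed simp
  obtain m where "N = j * m" using assms(1) by blast
  then have "l = l mod int N + int j * (int m * (l div int N))"
    by (metis add.commute mult.assoc mult_div_mod_eq of_nat_mult)
  then show ?thesis using p by metis
qed

lemma R_gens:
  assumes N: "N > 0" shows "{shift_op 1} \<union> B_diag N \<subseteq> psi_range N"
proof -
  note S = R_star[OF N]
  have W: "shift_op (int N) \<in> psi_range N"
  proof -
    have "theta N (tmono 1 1) = shift_op (int N)"
      unfolding theta_mono[OF N] by (rule op_eqI) simp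
    then show ?thesis using R_theta[OF C_circle_cis N, of 1 1] by simp
  qed
  have "shift_op 1 = (\<Sum>s<N. shift_op 1 o\<^sub>L P_op N s s)"
    unfolding comp_sum_right[symmetric] P_sum[OF N] by (rule op_eqI) simp
  also have "\<dots> \<in> psi_range N"
  proof (rule star_sum[OF S])
    fix s assume s: "s \<in> {..<N}"
    show "shift_op 1 o\<^sub>L P_op N s s \<in> psi_range N"
    proof (cases "Suc s < N")
      case True
      have "shift_op 1 o\<^sub>L P_op N s s = P_op N (Suc s) s"
        by (rule op_eqI) (simp add: algebra_simps)
      then show ?thesis using R_P[OF N True, of s] s by simp
    next
      case False
      with s have Ns: "N = Suc s" by simp
      have "shift_op 1 o\<^sub>L P_op N s s = shift_op (int N) o\<^sub>L P_op N 0 s"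
        by (rule op_eqI) (simp add: Ns algebra_simps)
      then show ?thesis using S W R_P[OF N N, of s] s by (simp add: star_subalgebra_def)
    qed
  qed
  finally have V: "shift_op 1 \<in> psi_range N" .
  have "diag_op b \<in> psi_range N" if bj: "bounded (range b)" "j dvd N" "\<And>l. b (l + int j) = b l" for b j
  proof -
    obtain C where C: "\<And>l. cmod (b l) \<le> C" using bj(1) unfolding bounded_iff by blast
    have "diag_op b = (\<Sum>s<N. cscale_op (b (int s)) (P_op N s s))"
    proof (rule op_eqI)
      fix x l
      have "coord ((\<Sum>s<N. cscale_op (b (int s)) (P_op N s s)) x) l = (\<Sum>s<N. if int N dvd l - int s then b (int s) * coord x l else 0)"
        unfolding coord_blinfun_sum by (intro sum.cong refl) simp
      also have "\<dots> = b l * coord x l"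
        using N dvd_period[of j N b l] bj(2,3) by (simp add: sum_residue)
      finally show "coord (diag_op b x) l = coord ((\<Sum>s<N. cscale_op (b (int s)) (P_op N s s)) x) l"
        by (simp add: coord_diag_op[OF C])
    qed
    also have "\<dots> \<in> psi_range N"
      using S R_P[OF N] by (intro star_sum) (auto simp: star_subalgebra_def)
    finally show ?thesis .
  qed
  then have "B_diag N \<subseteq> psi_range N" unfolding B_diag_def by blast
  with V show ?thesis by simp
qed

lemma bd_alg_eq_R: 
  assumes N: "N > 0" shows "bd_alg N = psi_range N"
proof
  show "bd_alg N \<subseteq> psi_range N"
    unfolding bd_alg_def using R_star[OF N] R_closed[OF N] R_gens[OF N] by blast
  show "psi_range N \<subseteq> bd_alg N"
    unfolding bd_alg_def
  proof (intro Inter_greatest subsetI)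
    fix S A assume "S \<in> {S. star_subalgebra S \<and> closed S \<and> {shift_op 1} \<union> B_diag N \<subseteq> S}" and A: "A \<in> psi_range N"
    then have S: "star_subalgebra S" "closed S" "shift_op 1 \<in> S" "B_diag N \<subseteq> S" by auto
    have comp: "A o\<^sub>L B \<in> S" if "A \<in> S" "B \<in> S" for A B using S(1) that by (auto simp: star_subalgebra_def)
    have sm1: "shift_op (- 1) \<in> S"
      using S(1,3) op_adjoint_eqI[OF is_adj_shift[of 1]] by (auto simp: star_subalgebra_def)
    have s0: "shift_op 0 \<in> S" using comp[OF S(3) sm1] by (simp add: shift_op_add)
    have sh: "shift_op k \<in> S" for k
    proof (induction k rule: int_induct[of _ 0])
      case (step1 i) then show ?case using comp[OF _ S(3), of "shift_op i"] by (simp add: shift_op_add)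
    next
      case (step2 i) then show ?case using comp[OF _ sm1, of "shift_op i"] by (simp add: shift_op_add)
    qed (rule s0)
    have "diag_op (\<lambda>l. if int N dvd l then 1 else 0) \<in> B_diag N"
      unfolding B_diag_def by (auto intro!: exI[of _ N] exI[of _ "\<lambda>l. if int N dvd l then 1 else 0"] simp: bounded_iff intro: exI[of _ 1])
    then have P: "P_op N s r \<in> S" for s r
      unfolding P_op_def using S(4) by (intro comp sh) auto
    from A obtain F where F: "F \<in> C_circle_mat N" "A = Psi N F" by (auto simp: psi_range_def)
    show "A \<in> S" unfolding F Psi_def
      using F(1) N by (intro star_sum[OF S(1)] comp P fc_mem[OF fc_theta[OF C_matD(1)[OF F(1)] N] S(1,2) sh]) auto
  qed
qed

theorem bd_identification_exists:
  assumes N: "N > 0" shows "\<exists>\<Phi>. bd_identification N \<Phi>"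
proof
  define \<Phi> where "\<Phi> = inv_into (C_circle_mat N) (Psi N)"
  note inj = Psi_inj[OF N]
  have ran: "bd_alg N = Psi N ` C_circle_mat N" using bd_alg_eq_R[OF N] by (simp add: psi_range_def)
  have eq: "\<Phi> A = F" if "F \<in> C_circle_mat N" "Psi N F = A" for A F
    unfolding \<Phi>_def using inv_into_f_f[OF inj that(1)] that(2) by simp
  have mem: "\<Phi> A \<in> C_circle_mat N" and inv: "Psi N (\<Phi> A) = A" if "A \<in> bd_alg N" for A
    using that unfolding ran \<Phi>_def by (rule inv_into_into, rule f_inv_into_f)
  have "theta N (tmono 1 1) = shift_op (int N)"
    unfolding theta_mono[OF N] by (rule op_eqI) simp
  then have W: "Psi N (\<lambda>t. cis t \<cdot>\<^sub>m 1\<^sub>m N) = shift_op (int N)"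
    using C_mat_diag(2)[OF C_circle_cis N, of 1 1] by simp
  have Wm: "(\<lambda>t. cis t \<cdot>\<^sub>m 1\<^sub>m N) \<in> C_circle_mat N"
    using C_mat_diag(1)[OF C_circle_cis N, of 1 1] by simp
  have u: "(\<lambda>t. mat_unit N s r) = (\<lambda>t. 1 \<cdot>\<^sub>m mat_unit N s r)" for s r
    by (auto simp: mat_unit_def intro!: eq_matI)
  have P: "\<Phi> (P_op N s r) = (\<lambda>t. mat_unit N s r)" if "s < N" "r < N" for s r
  proof -
    have "theta N (\<lambda>t. 1) o\<^sub>L P_op N s r = P_op N s r"
      unfolding theta_1[OF N] by (rule op_eqI) simp
    then show ?thesis unfolding u using C_mat_single[OF C_circle_const N that, of 1] by (intro eq) auto
  qed
  show "bd_identification N \<Phi>"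
    unfolding bd_identification_def
  proof (intro conjI ballI allI impI)
    show "bij_betw \<Phi> (bd_alg N) (C_circle_mat N)"
      unfolding ran \<Phi>_def using inj by (intro bij_betw_inv_into) (auto simp: bij_betw_def)
    show "\<Phi> (shift_op (int N)) = (\<lambda>t. cis t \<cdot>\<^sub>m 1\<^sub>m N)" by (rule eq[OF Wm W])
  next
    fix A B assume A: "A \<in> bd_alg N" and B: "B \<in> bd_alg N"
    show "\<Phi> (A + B) = (\<lambda>t. \<Phi> A t + \<Phi> B t)"
      by (rule eq) (simp_all add: C_mat_ops mem A B Psi_add N inv)
    show "\<Phi> (A o\<^sub>L B) = (\<lambda>t. \<Phi> A t * \<Phi> B t)"
      by (rule eq) (simp_all add: C_mat_ops mem A B Psi_mult N inv)
  next
    fix c A assume A: "A \<in> bd_alg N"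
    show "\<Phi> (cscale_op c A) = (\<lambda>t. c \<cdot>\<^sub>m \<Phi> A t)"
      by (rule eq) (simp_all add: C_mat_ops mem A Psi_scale N inv)
  next
    fix A assume A: "A \<in> bd_alg N"
    show "\<Phi> (op_adjoint A) = (\<lambda>t. mat_adjoint (\<Phi> A t))"
      using op_adjoint_eqI[OF Psi_adj[OF mem[OF A] N]]
      by (intro eq) (simp_all add: C_mat_ops mem A inv)
  qed (rule P)
qed

lemma bd_alg_adjoint:
  assumes N: "N > 0" and A: "A \<in> bd_alg N"
  shows "is_adj A (op_adjoint A)"
proof -
  obtain F where F: "F \<in> C_circle_mat N" and AF: "A = Psi N F"
    using A unfolding bd_alg_eq_R[OF N] psi_range_def by blast
  show ?thesis
    unfolding AF op_adjoint_eqI[OF Psi_adj[OF F N]] by (rule Psi_adj[OF F N])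
qed

lemma bd_poly_subset_bd_alg:
  assumes N: "N > 0" shows "bd_poly N \<subseteq> bd_alg N"
proof -
  note S = R_star[OF N]
  have V: "shift_op 1 \<in> psi_range N" "B_diag N \<subseteq> psi_range N" using R_gens[OF N] by auto
  have "shift_op (- 1) \<in> psi_range N"
    using S V(1) op_adjoint_eqI[OF is_adj_shift[of 1]] unfolding star_subalgebra_def by metis
  with S V show ?thesis unfolding bd_alg_eq_R[OF N] bd_poly_def by blast
qed

end

(* The element z = sum over s of \<delta>(P_s0) P_0s of B(N) satisfies [z, P_jk] = \<delta>(P_jk) for all matrix units, so \<delta> - [z, .]
   annihilates them.  As V^N commutes with the matrix units, so does its image under this difference, which is
   therefore a scalar function f(t) e^(it) times the identity matrix.  The difference then agrees with \<delta>_f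
   on V^N, V^(-N) and the matrix units, hence on the algebra they generate, which is all of the polynomial algebra.
   Conversely V^N is central in B(N), so inner derivations vanish on it and f can be read off from \<delta>(V^N). *)

theory Submission
  imports Defs
begin

section \<open>Generation by the matrix units and the central unitary\<close>

text \<open>Closure under adjoints is not built in: derivations need not respect them.\<close>

inductive_set unit_alg :: "nat \<Rightarrow> ell2_op set" for N where
  P: "s < N \<Longrightarrow> r < N \<Longrightarrow> P_op N s r \<in> unit_alg N"
| shift: "shift_op (int N) \<in> unit_alg N"
| shift_inv: "shift_op (- int N) \<in> unit_alg N"
| add: "A \<in> unit_alg N \<Longrightarrow> B \<in> unit_alg N \<Longrightarrow> A + B \<in> unit_alg N"
| scale: "A \<in> unit_alg N \<Longrightarrow> cscale_op c A \<in> unit_alg N"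
| mult: "A \<in> unit_alg N \<Longrightarrow> B \<in> unit_alg N \<Longrightarrow> A o\<^sub>L B \<in> unit_alg N"

lemma cscale_op_0: "cscale_op 0 A = 0"
  by (rule op_eqI) simp

lemma zero_in_unit_alg: "0 \<in> unit_alg N"
  \<comment> \<open>Zero arises as the multiple 0 of V^N, a generator present for every
    \<open>N\<close>.\<close>
  using unit_alg.scale[OF unit_alg.shift, of 0 N] by (simp add: cscale_op_0)

text \<open>The type \<open>ell2_op\<close> only guarantees real linearity. An adjoint forces
  complex linearity, because \<open>cinner\<close> is complex linear in its first argument and
  pairing with basis vectors recovers all coordinates.\<close>

lemma is_adj_linear:
  assumes "is_adj A B" shows "A o\<^sub>L diag_op (\<lambda>_. c) = diag_op (\<lambda>_. c) o\<^sub>L A"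
proof (rule op_eqI)
  fix x l
  have "cinner (A (diag_op (\<lambda>_. c) x)) (basis_vec l) = c * cinner (A x) (basis_vec l)"
    using assms by (simp add: is_adj_def cinner_scale_left)
  then show "coord ((A o\<^sub>L diag_op (\<lambda>_. c)) x) l = coord ((diag_op (\<lambda>_. c) o\<^sub>L A) x) l"
    by (simp add: cinner_basis)
qed

text \<open>Taking adjoints permutes the generators: it swaps the indices of \<open>P_op\<close> and
  exchanges V^N with V^(-N). Sums, multiples and products inherit the property.\<close>

lemma unit_alg_adj:
  assumes "A \<in> unit_alg N" shows "\<exists>B\<in>unit_alg N. is_adj A B"
  using assms
proof (induction rule: unit_alg.induct)
  case (P s r)
  then show ?case using P_adj unit_alg.P by blast
next
  case shift
  then show ?case using is_adj_shift unit_alg.shift_inv by blast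
next
  case shift_inv
  then show ?case using is_adj_shift[of "- int N"] unit_alg.shift by force
next
  case (add A B)
  then show ?case using is_adj_add unit_alg.add by blast
next
  case (scale A c)
  then obtain B where B: "B \<in> unit_alg N" "is_adj A B" by blast
  have "is_adj (diag_op (\<lambda>_. c) o\<^sub>L A) (B o\<^sub>L diag_op (\<lambda>_. cnj c))"
    using is_adj_comp[OF is_adj_scalar B(2)] .
  \<comment> \<open>The conjugated scalar lands to the right of \<open>B\<close>. Moving it to the
    left needs \<open>B\<close> to be complex linear, which holds because \<open>A\<close> is in
    turn an adjoint of \<open>B\<close>.\<close>
  also have "B o\<^sub>L diag_op (\<lambda>_. cnj c) = cscale_op (cnj c) B"
  proof -
    have "is_adj B A"
      using B(2) unfolding is_adj_def by (metis cinner_cnj)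
    then show ?thesis unfolding cscale_op_def by (rule is_adj_linear)
  qed
  finally show ?case unfolding cscale_op_def[symmetric] using unit_alg.scale[OF B(1)] by blast
next
  case (mult A B)
  then show ?case using is_adj_comp unit_alg.mult by blast
qed

lemma star_subalgebra_unit_alg: "star_subalgebra (unit_alg N)"
  unfolding star_subalgebra_def
proof (intro conjI ballI allI)
  fix A assume "A \<in> unit_alg N"
  then obtain B where "B \<in> unit_alg N" "is_adj A B" using unit_alg_adj by blast
  then show "op_adjoint A \<in> unit_alg N" using op_adjoint_eqI by simp
qed (auto intro: zero_in_unit_alg unit_alg.intros)

text \<open>V is the sum of the V P_ss, and V carries the residue class of s to that of s + 1. Each
  summand is a single matrix unit, except for the last class, which wraps around.\<close>

lemma shift_1_in_unit_alg:
  assumes N: "N > 0" shows "shift_op 1 \<in> unit_alg N"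
proof -
  have "shift_op 1 = (\<Sum>s<N. shift_op 1 o\<^sub>L P_op N s s)"
    unfolding comp_sum_right[symmetric] P_sum[OF N] by (rule op_eqI) simp
  also have "\<dots> \<in> unit_alg N"
  proof (rule star_sum[OF star_subalgebra_unit_alg])
    fix s assume s: "s \<in> {..<N}"
    show "shift_op 1 o\<^sub>L P_op N s s \<in> unit_alg N"
    proof (cases "Suc s < N")
      case True
      have "shift_op 1 o\<^sub>L P_op N s s = P_op N (Suc s) s"
        by (rule op_eqI) (simp add: algebra_simps)
      then show ?thesis using unit_alg.P[OF True, of s] s by simp
    next
      case False
      with s have Ns: "N = Suc s" by simp
      \<comment> \<open>Here s = N - 1: class 0 is reached one full period later, which accounts for
        the factor V^N.\<close>
      have "shift_op 1 o\<^sub>L P_op N s s = shift_op (int N) o\<^sub>L P_op N 0 s"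
        by (rule op_eqI) (simp add: Ns algebra_simps)
      then show ?thesis using unit_alg.mult[OF unit_alg.shift unit_alg.P[OF N, of s]] s by simp
    qed
  qed
  finally show ?thesis .
qed

text \<open>A period dividing \<open>N\<close> makes \<open>b\<close> constant on residue classes
  modulo \<open>N\<close>, and P_ss projects onto the class of s. So \<open>diag_op b\<close> is a
  finite combination of diagonal matrix units.\<close>

lemma B_diag_subset_unit_alg:
  assumes N: "N > 0" shows "B_diag N \<subseteq> unit_alg N"
proof -
  have "diag_op b \<in> unit_alg N"
    if bj: "bounded (range b)" "j dvd N" "\<And>l. b (l + int j) = b l" for b j
  proof -
    obtain C where C: "\<And>l. cmod (b l) \<le> C" using bj(1) unfolding bounded_iff by blast
    have "diag_op b = (\<Sum>s<N. cscale_op (b (int s)) (P_op N s s))"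
    proof (rule op_eqI)
      fix x l
      have "coord ((\<Sum>s<N. cscale_op (b (int s)) (P_op N s s)) x) l
          = (\<Sum>s<N. if int N dvd l - int s then b (int s) * coord x l else 0)"
        unfolding coord_blinfun_sum by (intro sum.cong refl) simp
      also have "\<dots> = b l * coord x l"
        using N dvd_period[of j N b l] bj(2,3) by (simp add: sum_residue)
      finally show "coord (diag_op b x) l = coord ((\<Sum>s<N. cscale_op (b (int s)) (P_op N s s)) x) l"
        by (simp add: coord_diag_op[OF C])
    qed
    also have "\<dots> \<in> unit_alg N"
      by (intro star_sum[OF star_subalgebra_unit_alg] unit_alg.scale unit_alg.P) auto
    finally show ?thesis .
  qed
  then show ?thesis unfolding B_diag_def by blast
qed

lemma star_subalgebra_bd_poly: "star_subalgebra (bd_poly N)"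
  unfolding bd_poly_def star_subalgebra_def by auto

lemma shift_op_in_bd_poly: "shift_op k \<in> bd_poly N"
proof -
  have g: "shift_op 1 \<in> bd_poly N" "shift_op (- 1) \<in> bd_poly N"
    unfolding bd_poly_def by auto
  have comp: "A o\<^sub>L B \<in> bd_poly N" if "A \<in> bd_poly N" "B \<in> bd_poly N" for A B
    using star_subalgebra_bd_poly that by (auto simp: star_subalgebra_def)
  show ?thesis
  proof (induction k rule: int_induct[of _ 0])
    case base
    then show ?case using comp[OF g] by (simp add: shift_op_add)
  next
    case (step1 i)
    then show ?case using comp[OF _ g(1), of "shift_op i"] by (simp add: shift_op_add)
  next
    case (step2 i)
    then show ?case using comp[OF _ g(2), of "shift_op i"] by (simp add: shift_op_add)
  qed
qed

lemma P_op_in_bd_poly: "P_op N s r \<in> bd_poly N"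
proof -
  have "diag_op (\<lambda>l. if int N dvd l then 1 else 0) \<in> B_diag N"
    unfolding B_diag_def
    by (auto intro!: exI[of _ N] exI[of _ "\<lambda>l. if int N dvd l then 1 else 0"] simp: bounded_iff
        intro: exI[of _ 1])
  then have "diag_op (\<lambda>l. if int N dvd l then 1 else 0) \<in> bd_poly N"
    unfolding bd_poly_def by auto
  then show ?thesis
    using star_subalgebra_bd_poly shift_op_in_bd_poly unfolding P_op_def star_subalgebra_def by blast
qed

text \<open>Turns an intersection of subalgebras into an inductive set, so that statements about
  derivations can be proved by induction with no case for adjoints. V^(-1) enters as the adjoint of
  V.\<close>

lemma bd_poly_eq_unit_alg:
  assumes "N > 0" shows "bd_poly N = unit_alg N"
proof
  have "shift_op (- 1) \<in> unit_alg N"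
    using star_subalgebra_unit_alg shift_1_in_unit_alg[OF assms] op_adjoint_eqI[OF is_adj_shift[of 1]]
    unfolding star_subalgebra_def by metis
  then show "bd_poly N \<subseteq> unit_alg N"
    using star_subalgebra_unit_alg shift_1_in_unit_alg[OF assms] B_diag_subset_unit_alg[OF assms]
    unfolding bd_poly_def by blast
  show "unit_alg N \<subseteq> bd_poly N"
  proof
    fix A assume "A \<in> unit_alg N"
    then show "A \<in> bd_poly N"
      by (induction rule: unit_alg.induct)
         (use star_subalgebra_bd_poly shift_op_in_bd_poly P_op_in_bd_poly in \<open>auto simp: star_subalgebra_def\<close>)
  qed
qed

section \<open>Derivations\<close>

lemma cscale_op_minus_1: "cscale_op (- 1) A = - A"
  by (rule op_eqI) (simp add: blinfun.bilinear_simps)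

lemma cscale_op_diff: "cscale_op c (A - B) = cscale_op c A - cscale_op c B"
  by (rule op_eqI) (simp add: algebra_simps)

lemma cscale_comp_left: "cscale_op c A o\<^sub>L B = cscale_op c (A o\<^sub>L B)"
  by (simp add: cscale_op_def comp_assoc_op)

lemmas comp_diff_left = bounded_bilinear.diff_left[OF bounded_bilinear_blinfun_compose]
lemmas comp_diff_right = bounded_bilinear.diff_right[OF bounded_bilinear_blinfun_compose]

lemma id_comp [simp]: "id_blinfun o\<^sub>L A = (A :: ell2_op)" "A o\<^sub>L id_blinfun = (A :: ell2_op)"
  by (rule op_eqI, simp)+

lemma star_subalgebra_bd_alg:
  assumes "N > 0" shows "star_subalgebra (bd_alg N)"
  unfolding bd_alg_eq_R[OF assms] by (rule R_star[OF assms])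

lemma bd_alg_closed:
  assumes "N > 0" "A \<in> bd_alg N"
  shows "B \<in> bd_alg N \<Longrightarrow> A + B \<in> bd_alg N" "B \<in> bd_alg N \<Longrightarrow> A o\<^sub>L B \<in> bd_alg N"
    "cscale_op c A \<in> bd_alg N" "op_adjoint A \<in> bd_alg N"
  using star_subalgebra_bd_alg[OF assms(1)] assms(2) by (auto simp: star_subalgebra_def)

lemma bd_alg_diff:
  assumes "N > 0" "A \<in> bd_alg N" "B \<in> bd_alg N" shows "A - B \<in> bd_alg N"
  using bd_alg_closed(1)[OF assms(1,2) bd_alg_closed(3)[OF assms(1,3), of "-1"]]
  by (simp add: cscale_op_minus_1)

text \<open>Scalars act by composition from the left, so pulling one out of the right factor
  requires the left factor to be complex linear. Members of \<open>bd_alg N\<close> are, since they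
  have adjoints.\<close>

lemma comp_cscale_right:
  assumes "N > 0" "A \<in> bd_alg N" shows "A o\<^sub>L cscale_op c B = cscale_op c (A o\<^sub>L B)"
  unfolding cscale_op_def
  by (simp only: comp_assoc_op[symmetric] is_adj_linear[OF bd_alg_adjoint[OF assms]])

lemma bd_poly_mem: "N > 0 \<Longrightarrow> b \<in> bd_poly N \<Longrightarrow> b \<in> bd_alg N"
  using bd_poly_subset_bd_alg by blast

lemma bd_derivation_commutator:
  assumes N: "N > 0" and z: "z \<in> bd_alg N"
  shows "bd_derivation N (\<lambda>b. (z o\<^sub>L b) - (b o\<^sub>L z))"
  unfolding bd_derivation_def
proof (intro conjI ballI allI)
  fix a assume a: "a \<in> bd_poly N"
  show "(z o\<^sub>L a) - (a o\<^sub>L z) \<in> bd_alg N"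
    using N z bd_poly_mem[OF N a] by (intro bd_alg_diff bd_alg_closed(2))
  show "(z o\<^sub>L cscale_op c a) - (cscale_op c a o\<^sub>L z) = cscale_op c ((z o\<^sub>L a) - (a o\<^sub>L z))" for c
    by (simp add: comp_cscale_right[OF N z] cscale_comp_left cscale_op_diff)
  fix b
  show "(z o\<^sub>L (a + b)) - ((a + b) o\<^sub>L z) = ((z o\<^sub>L a) - (a o\<^sub>L z)) + ((z o\<^sub>L b) - (b o\<^sub>L z))"
    by (simp add: comp_add_left comp_add_right)
  \<comment> \<open>Since \<open>o\<^sub>L\<close> binds more weakly than \<open>-\<close>, the
    commutators on the right-hand side are whole factors; the two terms a z b cancel.\<close>
  show "(z o\<^sub>L (a o\<^sub>L b)) - (a o\<^sub>L b o\<^sub>L z) = ((z o\<^sub>L a) - (a o\<^sub>L z) o\<^sub>L b) + (a o\<^sub>L (z o\<^sub>L b) - (b o\<^sub>L z))"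
    by (simp add: comp_diff_left comp_diff_right comp_assoc_op)
qed

lemma bd_derivation_diff:
  assumes N: "N > 0" and D: "bd_derivation N D" and E: "bd_derivation N E"
  shows "bd_derivation N (\<lambda>b. D b - E b)"
  using D E bd_alg_diff[OF N]
  by (auto simp: bd_derivation_def cscale_op_diff comp_diff_left comp_diff_right)

text \<open>In z P_jk only the summand s = j survives. In P_jk z the Leibniz rule yields the same
  term minus the sum of the D(P_jk) P_ss, which is D(P_jk) because the diagonal units add up to the
  identity.\<close>

lemma derivation_inner_on_units:
  assumes N: "N > 0" and D: "bd_derivation N D"
  obtains z where "z \<in> bd_alg N"
    "\<And>j k. j < N \<Longrightarrow> k < N \<Longrightarrow> D (P_op N j k) = (z o\<^sub>L P_op N j k) - (P_op N j k o\<^sub>L z)"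
proof
  define z where "z = (\<Sum>s<N. D (P_op N s 0) o\<^sub>L P_op N 0 s)"
  note Pm = P_op_in_bd_poly
  have mult: "D (a o\<^sub>L b) = (D a o\<^sub>L b) + (a o\<^sub>L D b)" if "a \<in> bd_poly N" "b \<in> bd_poly N" for a b
    using D that unfolding bd_derivation_def by blast
  have "0 \<in> bd_poly N" using star_subalgebra_bd_poly by (auto simp: star_subalgebra_def)
  \<comment> \<open>Products of mismatched matrix units are 0, so the value of \<open>D\<close>
    there is needed below.\<close>
  then have D0: "D 0 = 0" using mult[of 0 0] by simp
  show "z \<in> bd_alg N"
    unfolding z_def using D Pm
    by (intro star_sum[OF star_subalgebra_bd_alg[OF N]] bd_alg_closed(2)[OF N] bd_poly_mem[OF N Pm])
       (auto simp: bd_derivation_def)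
  fix j k assume j: "j < N" and k: "k < N"
  have "z o\<^sub>L P_op N j k = (\<Sum>s<N. if s = j then D (P_op N j 0) o\<^sub>L P_op N 0 k else 0)"
    unfolding z_def comp_sum_left using j by (intro sum.cong refl) (auto simp: comp_assoc_op P_mult)
  then have zP: "z o\<^sub>L P_op N j k = D (P_op N j 0) o\<^sub>L P_op N 0 k" using j by simp
  have "P_op N j k o\<^sub>L z = (\<Sum>s<N. (if s = k then D (P_op N j 0) o\<^sub>L P_op N 0 k else 0) - (D (P_op N j k) o\<^sub>L P_op N s s))"
    unfolding z_def comp_sum_right
  proof (intro sum.cong refl)
    fix s assume "s \<in> {..<N}"
    then have s: "s < N" by simp
    \<comment> \<open>The Leibniz rule is solved for the term in which \<open>D\<close> acts on the
      right factor, since that is what occurs in P_jk z.\<close>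
    have "P_op N j k o\<^sub>L D (P_op N s 0) = D (P_op N j k o\<^sub>L P_op N s 0) - (D (P_op N j k) o\<^sub>L P_op N s 0)"
      using mult[OF Pm Pm] by simp
    then have "P_op N j k o\<^sub>L (D (P_op N s 0) o\<^sub>L P_op N 0 s)
        = (D (P_op N j k o\<^sub>L P_op N s 0) o\<^sub>L P_op N 0 s) - (D (P_op N j k) o\<^sub>L (P_op N s 0 o\<^sub>L P_op N 0 s))"
      by (simp only: comp_assoc_op[symmetric] comp_diff_left)
    also have "\<dots> = (if s = k then D (P_op N j 0) o\<^sub>L P_op N 0 k else 0) - (D (P_op N j k) o\<^sub>L P_op N s s)"
      using k s N by (simp add: P_mult D0)
    finally show "P_op N j k o\<^sub>L (D (P_op N s 0) o\<^sub>L P_op N 0 s) = \<dots>" .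
  qed
  also have "\<dots> = (D (P_op N j 0) o\<^sub>L P_op N 0 k) - D (P_op N j k)"
    using k by (simp add: sum_subtractf comp_sum_right[symmetric] P_sum[OF N])
  finally show "D (P_op N j k) = (z o\<^sub>L P_op N j k) - (P_op N j k o\<^sub>L z)"
    unfolding zP by simp
qed

section \<open>Entrywise differentiation of matrix-valued functions\<close>

text \<open>\<open>circle_derivation\<close> is built on \<open>vector_derivative\<close>, which
  carries no information where the entries are not differentiable. The relation also records
  differentiability, so it passes through sums and products and suits induction.\<close>

definition is_circle_deriv ::
  "nat \<Rightarrow> (real \<Rightarrow> complex) \<Rightarrow> (real \<Rightarrow> complex mat) \<Rightarrow> (real \<Rightarrow> complex mat) \<Rightarrow> bool" where
  "is_circle_deriv N f F G \<longleftrightarrow> (\<exists>F'. \<forall>i<N. \<forall>j<N. \<forall>t.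
     ((\<lambda>u. F u $$ (i, j)) has_vector_derivative F' i j t) (at t) \<and> G t $$ (i, j) = f t * (1 / \<i> * F' i j t))"

lemma is_circle_derivI:
  assumes "\<And>i j t. i < N \<Longrightarrow> j < N \<Longrightarrow> ((\<lambda>u. F u $$ (i, j)) has_vector_derivative F' i j t) (at t)"
    and "\<And>i j t. i < N \<Longrightarrow> j < N \<Longrightarrow> G t $$ (i, j) = f t * (1 / \<i> * F' i j t)"
  shows "is_circle_deriv N f F G"
  using assms unfolding is_circle_deriv_def by blast

lemma is_circle_derivE:
  assumes "is_circle_deriv N f F G"
  obtains F' where
    "\<And>i j t. i < N \<Longrightarrow> j < N \<Longrightarrow> ((\<lambda>u. F u $$ (i, j)) has_vector_derivative F' i j t) (at t)"
    "\<And>i j t. i < N \<Longrightarrow> j < N \<Longrightarrow> G t $$ (i, j) = f t * (1 / \<i> * F' i j t)"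
  using assms unfolding is_circle_deriv_def by blast

lemma circle_derivation_eqI:
  assumes "is_circle_deriv N f F G" "\<And>t. G t \<in> carrier_mat N N"
  shows "circle_derivation N f F = G"
proof
  fix t
  obtain F' where d:
    "\<And>i j t. i < N \<Longrightarrow> j < N \<Longrightarrow> ((\<lambda>u. F u $$ (i, j)) has_vector_derivative F' i j t) (at t)"
    "\<And>i j t. i < N \<Longrightarrow> j < N \<Longrightarrow> G t $$ (i, j) = f t * (1 / \<i> * F' i j t)"
    using assms(1) by (elim is_circle_derivE) blast
  show "circle_derivation N f F t = G t"
  proof (rule eq_matI)
    fix i j assume "i < dim_row (G t)" "j < dim_col (G t)"
    then have ij: "i < N" "j < N" using assms(2)[of t] by auto
    then show "circle_derivation N f F t $$ (i, j) = G t $$ (i, j)"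
      unfolding circle_derivation_def d(2)[OF ij] by (simp add: vector_derivative_at[OF d(1)[OF ij]])
  qed (use assms(2)[of t] in \<open>auto simp: circle_derivation_def\<close>)
qed

lemma mat_mult_index:
  assumes "A \<in> carrier_mat N N" "B \<in> carrier_mat N N" "i < N" "j < N"
  shows "(A * B :: 'a :: semiring_0 mat) $$ (i, j) = (\<Sum>k<N. A $$ (i, k) * B $$ (k, j))"
proof -
  have "(A * B) $$ (i, j) = Matrix.row A i \<bullet> Matrix.col B j" using assms by simp
  also have "\<dots> = (\<Sum>k<N. A $$ (i, k) * B $$ (k, j))"
    unfolding scalar_prod_def using assms by (auto simp: lessThan_atLeast0 intro!: sum.cong)
  finally show ?thesis .
qed

lemma is_circle_deriv_add:
  assumes "is_circle_deriv N f F G" "is_circle_deriv N f F2 G2"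
    and "\<And>t. F2 t \<in> carrier_mat N N" "\<And>t. G2 t \<in> carrier_mat N N"
  shows "is_circle_deriv N f (\<lambda>t. F t + F2 t) (\<lambda>t. G t + G2 t)"
proof -
  obtain F' F2' where d:
    "\<And>i j t. i < N \<Longrightarrow> j < N \<Longrightarrow> ((\<lambda>u. F u $$ (i, j)) has_vector_derivative F' i j t) (at t)"
    "\<And>i j t. i < N \<Longrightarrow> j < N \<Longrightarrow> G t $$ (i, j) = f t * (1 / \<i> * F' i j t)"
    "\<And>i j t. i < N \<Longrightarrow> j < N \<Longrightarrow> ((\<lambda>u. F2 u $$ (i, j)) has_vector_derivative F2' i j t) (at t)"
    "\<And>i j t. i < N \<Longrightarrow> j < N \<Longrightarrow> G2 t $$ (i, j) = f t * (1 / \<i> * F2' i j t)"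
    using assms(1,2) by (elim is_circle_derivE) blast
  have [simp]: "dim_row (F2 t) = N" "dim_col (F2 t) = N" "dim_row (G2 t) = N" "dim_col (G2 t) = N" for t
    using assms(3,4)[of t] by auto
  show ?thesis
    by (rule is_circle_derivI[where F' = "\<lambda>i j t. F' i j t + F2' i j t"])
       (auto intro!: has_vector_derivative_add d(1,3) simp: d(2,4) algebra_simps)
qed

lemma is_circle_deriv_scale:
  assumes "is_circle_deriv N f F G"
    and "\<And>t. F t \<in> carrier_mat N N" "\<And>t. G t \<in> carrier_mat N N"
  shows "is_circle_deriv N f (\<lambda>t. c \<cdot>\<^sub>m F t) (\<lambda>t. c \<cdot>\<^sub>m G t)"
proof -
  obtain F' where d:
    "\<And>i j t. i < N \<Longrightarrow> j < N \<Longrightarrow> ((\<lambda>u. F u $$ (i, j)) has_vector_derivative F' i j t) (at t)"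
    "\<And>i j t. i < N \<Longrightarrow> j < N \<Longrightarrow> G t $$ (i, j) = f t * (1 / \<i> * F' i j t)"
    using assms(1) by (elim is_circle_derivE) blast
  have [simp]: "dim_row (F t) = N" "dim_col (F t) = N" "dim_row (G t) = N" "dim_col (G t) = N" for t
    using assms(2,3)[of t] by auto
  show ?thesis
    by (rule is_circle_derivI[where F' = "\<lambda>i j t. c * F' i j t"])
       (auto intro!: has_vector_derivative_mult_right d(1) simp: d(2))
qed

text \<open>The product rule holds for each entry of the matrix product with the order of factors
  kept; \<open>f\<close> is scalar and can be pulled out of both terms.\<close>

lemma is_circle_deriv_mult:
  assumes "is_circle_deriv N f F G" "is_circle_deriv N f F2 G2"
    and c: "\<And>t. F t \<in> carrier_mat N N" "\<And>t. G t \<in> carrier_mat N N"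
      "\<And>t. F2 t \<in> carrier_mat N N" "\<And>t. G2 t \<in> carrier_mat N N"
  shows "is_circle_deriv N f (\<lambda>t. F t * F2 t) (\<lambda>t. G t * F2 t + F t * G2 t)"
proof -
  obtain F' F2' where d:
    "\<And>i j t. i < N \<Longrightarrow> j < N \<Longrightarrow> ((\<lambda>u. F u $$ (i, j)) has_vector_derivative F' i j t) (at t)"
    "\<And>i j t. i < N \<Longrightarrow> j < N \<Longrightarrow> G t $$ (i, j) = f t * (1 / \<i> * F' i j t)"
    "\<And>i j t. i < N \<Longrightarrow> j < N \<Longrightarrow> ((\<lambda>u. F2 u $$ (i, j)) has_vector_derivative F2' i j t) (at t)"
    "\<And>i j t. i < N \<Longrightarrow> j < N \<Longrightarrow> G2 t $$ (i, j) = f t * (1 / \<i> * F2' i j t)"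
    using assms(1,2) by (elim is_circle_derivE) blast
  show ?thesis
  proof (rule is_circle_derivI[where F' = "\<lambda>i j t. \<Sum>k<N. F t $$ (i, k) * F2' k j t + F' i k t * F2 t $$ (k, j)"])
    fix i j t assume ij: "i < N" "j < N"
    show "((\<lambda>u. (F u * F2 u) $$ (i, j)) has_vector_derivative
        (\<Sum>k<N. F t $$ (i, k) * F2' k j t + F' i k t * F2 t $$ (k, j))) (at t)"
      unfolding mat_mult_index[OF c(1,3) ij]
      by (intro has_vector_derivative_sum has_vector_derivative_mult d(1,3)) (use ij in auto)
    have "dim_row (F t * G2 t) = N" "dim_col (F t * G2 t) = N" using c(1,4)[of t] by auto
    then have "(G t * F2 t + F t * G2 t) $$ (i, j) = (G t * F2 t) $$ (i, j) + (F t * G2 t) $$ (i, j)"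
      using ij by simp
    also have "\<dots> = (\<Sum>k<N. f t * (1 / \<i> * (F t $$ (i, k) * F2' k j t + F' i k t * F2 t $$ (k, j))))"
      unfolding mat_mult_index[OF c(1,4) ij] mat_mult_index[OF c(2,3) ij] sum.distrib[symmetric]
      by (intro sum.cong refl) (simp add: ij d(2,4) algebra_simps add_divide_distrib)
    finally show "(G t * F2 t + F t * G2 t) $$ (i, j)
        = f t * (1 / \<i> * (\<Sum>k<N. F t $$ (i, k) * F2' k j t + F' i k t * F2 t $$ (k, j)))"
      by (simp only: sum_distrib_left)
  qed
qed

text \<open>The factor \<i> from differentiating the exponential cancels 1 / \<i>, leaving
  \<open>a\<close>. The cases \<open>a\<close> = 1 and \<open>a\<close> = -1 serve V^N and
  V^(-N).\<close>

lemma is_circle_deriv_cis: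
  "is_circle_deriv N f (\<lambda>t. cis (a * t) \<cdot>\<^sub>m 1\<^sub>m N) (\<lambda>t. (f t * a * cis (a * t)) \<cdot>\<^sub>m 1\<^sub>m N)"
proof (rule is_circle_derivI[where F' = "\<lambda>i j t. if i = j then \<i> * a * cis (a * t) else 0"])
  fix i j t assume ij: "i < N" "j < N"
  have "((\<lambda>z. exp (\<i> * a * z)) has_field_derivative \<i> * a * exp (\<i> * a * complex_of_real t)) (at (complex_of_real t))"
    by (auto intro!: derivative_eq_intros)
  from has_vector_derivative_real_field[OF this]
  have "((\<lambda>u. cis (a * u)) has_vector_derivative \<i> * a * cis (a * t)) (at t)"
    by (simp add: cis_conv_exp mult.assoc)
  then show "((\<lambda>u. (cis (a * u) \<cdot>\<^sub>m 1\<^sub>m N) $$ (i, j)) has_vector_derivative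
      (if i = j then \<i> * a * cis (a * t) else 0)) (at t)"
    using ij by auto
qed (auto simp: algebra_simps)

section \<open>Scalar values on the commutant of the matrix units\<close>

lemma mat_commuting_units_scalar:
  assumes N: "N > 0" and M: "M \<in> carrier_mat N N"
    and comm: "\<And>s r. s < N \<Longrightarrow> r < N \<Longrightarrow> M * mat_unit N s r = mat_unit N s r * M"
  shows "M = M $$ (0, 0) \<cdot>\<^sub>m 1\<^sub>m N"
proof (rule eq_matI)
  fix i j assume "i < dim_row (M $$ (0, 0) \<cdot>\<^sub>m 1\<^sub>m N)" "j < dim_col (M $$ (0, 0) \<cdot>\<^sub>m 1\<^sub>m N)"
  then have ij: "i < N" "j < N" by auto
  have U: "mat_unit N s r \<in> carrier_mat N N" for s r by (simp add: mat_unit_def)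
  have "(if b = r then M $$ (a, s) else 0) = (if a = s then M $$ (r, b) else 0)"
    if "a < N" "b < N" "s < N" "r < N" for a b s r
  proof -
    have "(M * mat_unit N s r) $$ (a, b) = (\<Sum>k<N. if k = s then if b = r then M $$ (a, s) else 0 else 0)"
      unfolding mat_mult_index[OF M U that(1,2)] using that by (intro sum.cong) (auto simp: mat_unit_def)
    moreover have "(mat_unit N s r * M) $$ (a, b) = (\<Sum>k<N. if k = r then if a = s then M $$ (r, b) else 0 else 0)"
      unfolding mat_mult_index[OF U M that(1,2)] using that by (intro sum.cong) (auto simp: mat_unit_def)
    ultimately show ?thesis using comm[OF that(3,4)] that by simp
  qed
  \<comment> \<open>The first instance shows that entries off the diagonal vanish, the second that
    every diagonal entry equals the one at (0, 0).\<close>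
  from this[of i j j j] this[of j 0 j 0] show "M $$ (i, j) = (M $$ (0, 0) \<cdot>\<^sub>m 1\<^sub>m N) $$ (i, j)"
    using ij N by (auto split: if_splits)
qed (use M in auto)

section \<open>Transport between operators and matrix-valued functions on the circle\<close>

locale bunce_deddens =
  fixes N :: nat and \<Phi> :: "ell2_op \<Rightarrow> real \<Rightarrow> complex mat"
  assumes N: "N > 0" and ident: "bd_identification N \<Phi>"
begin

lemmas mem = bd_poly_mem[OF N]

lemma shift_mem: "shift_op k \<in> bd_alg N"
  by (rule mem[OF shift_op_in_bd_poly])

lemma P_mem: "P_op N s r \<in> bd_alg N"
  by (rule mem[OF P_op_in_bd_poly])

lemma Phi_mem: "A \<in> bd_alg N \<Longrightarrow> \<Phi> A \<in> C_circle_mat N"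
  using ident unfolding bd_identification_def by (blast dest: bij_betwE)

lemma Phi_carrier: "A \<in> bd_alg N \<Longrightarrow> \<Phi> A t \<in> carrier_mat N N"
  by (rule C_matD(2)[OF Phi_mem])

lemma Phi_inj: "\<Phi> A = \<Phi> B \<Longrightarrow> A \<in> bd_alg N \<Longrightarrow> B \<in> bd_alg N \<Longrightarrow> A = B"
  using ident unfolding bd_identification_def bij_betw_def inj_on_def by blast

lemma Phi_inv: "A \<in> bd_alg N \<Longrightarrow> inv_into (bd_alg N) \<Phi> (\<Phi> A) = A"
  using ident unfolding bd_identification_def bij_betw_def by (simp add: inv_into_f_f)

lemma Phi_surj: "F \<in> C_circle_mat N \<Longrightarrow> \<Phi> (inv_into (bd_alg N) \<Phi> F) = F"
  using ident unfolding bd_identification_def bij_betw_def by (auto intro: f_inv_into_f)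

lemma Phi_ops:
  "A \<in> bd_alg N \<Longrightarrow> B \<in> bd_alg N \<Longrightarrow> \<Phi> (A + B) = (\<lambda>t. \<Phi> A t + \<Phi> B t)"
  "A \<in> bd_alg N \<Longrightarrow> \<Phi> (cscale_op c A) = (\<lambda>t. c \<cdot>\<^sub>m \<Phi> A t)"
  "A \<in> bd_alg N \<Longrightarrow> B \<in> bd_alg N \<Longrightarrow> \<Phi> (A o\<^sub>L B) = (\<lambda>t. \<Phi> A t * \<Phi> B t)"
  "A \<in> bd_alg N \<Longrightarrow> \<Phi> (op_adjoint A) = (\<lambda>t. mat_adjoint (\<Phi> A t))"
  using ident unfolding bd_identification_def by auto

lemma Phi_P: "s < N \<Longrightarrow> r < N \<Longrightarrow> \<Phi> (P_op N s r) = (\<lambda>t. mat_unit N s r)"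
  and Phi_shift: "\<Phi> (shift_op (int N)) = (\<lambda>t. cis t \<cdot>\<^sub>m 1\<^sub>m N)"
  using ident unfolding bd_identification_def by auto

text \<open>V^(-N) is the adjoint of V^N, so preservation of adjoints determines its image.\<close>

lemma Phi_shift_inv: "\<Phi> (shift_op (- int N)) = (\<lambda>t. cis (- t) \<cdot>\<^sub>m 1\<^sub>m N)"
proof -
  have "\<Phi> (shift_op (- int N)) = (\<lambda>t. mat_adjoint (cis t \<cdot>\<^sub>m 1\<^sub>m N))"
    using Phi_ops(4)[OF shift_mem, of "int N"] by (simp add: op_adjoint_eqI[OF is_adj_shift] Phi_shift)
  also have "\<dots> = (\<lambda>t. cis (- t) \<cdot>\<^sub>m 1\<^sub>m N)"
  proof
    fix t
    have c: "cis t \<cdot>\<^sub>m 1\<^sub>m N \<in> carrier_mat N N" by simp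
    show "mat_adjoint (cis t \<cdot>\<^sub>m 1\<^sub>m N) = cis (- t) \<cdot>\<^sub>m 1\<^sub>m N"
      using mat_adjoint_carrier[OF c] by (intro eq_matI) (auto simp: mat_adjoint_index[OF c] cis_cnj)
  qed
  finally show ?thesis .
qed

lemma Phi_0: "i < N \<Longrightarrow> j < N \<Longrightarrow> \<Phi> 0 t $$ (i, j) = 0"
proof -
  have 0: "0 \<in> bd_alg N" using star_subalgebra_bd_alg[OF N] by (simp add: star_subalgebra_def)
  assume "i < N" "j < N"
  then have "(0 \<cdot>\<^sub>m \<Phi> 0 t) $$ (i, j) = 0" using Phi_carrier[OF 0, of t] by auto
  \<comment> \<open>The zero operator is 0 times itself, so homogeneity of \<open>\<Phi>\<close>
    makes its image vanish.\<close>
  moreover have "\<Phi> 0 t = 0 \<cdot>\<^sub>m \<Phi> 0 t"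
    using fun_cong[OF Phi_ops(2)[OF 0, of 0], of t] by (simp only: cscale_op_0)
  ultimately show ?thesis by metis
qed

text \<open>The image of V^N is a scalar function times the identity matrix, and
  \<open>\<Phi>\<close> is injective.\<close>

lemma shift_central:
  assumes A: "A \<in> bd_alg N" shows "A o\<^sub>L shift_op (int N) = shift_op (int N) o\<^sub>L A"
proof (rule Phi_inj)
  have "\<Phi> A t * (cis t \<cdot>\<^sub>m 1\<^sub>m N) = (cis t \<cdot>\<^sub>m 1\<^sub>m N) * \<Phi> A t" for t
    using Phi_carrier[OF A, of t] by auto
  then show "\<Phi> (A o\<^sub>L shift_op (int N)) = \<Phi> (shift_op (int N) o\<^sub>L A)"
    by (simp add: Phi_ops A shift_mem Phi_shift)
qed (intro bd_alg_closed N A shift_mem)+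

lemma Phi_commutant:
  assumes A: "A \<in> bd_alg N"
    and comm: "\<And>s r. s < N \<Longrightarrow> r < N \<Longrightarrow> A o\<^sub>L P_op N s r = P_op N s r o\<^sub>L A"
  shows "\<Phi> A t = \<Phi> A t $$ (0, 0) \<cdot>\<^sub>m 1\<^sub>m N"
proof (rule mat_commuting_units_scalar[OF N Phi_carrier[OF A]])
  fix s r assume sr: "s < N" "r < N"
  from comm[OF sr] have "\<Phi> (A o\<^sub>L P_op N s r) t = \<Phi> (P_op N s r o\<^sub>L A) t" by simp
  then show "\<Phi> A t * mat_unit N s r = mat_unit N s r * \<Phi> A t"
    by (simp add: Phi_ops A P_mem Phi_P sr)
qed

text \<open>The differentiated function is the image of \<open>A\<close>, so the inverse in
  \<open>bd_delta\<close> is applied inside the range of \<open>\<Phi>\<close> and returns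
  \<open>A\<close>.\<close>

lemma bd_delta_eqI:
  assumes "A \<in> bd_alg N" "is_circle_deriv N f (\<Phi> b) (\<Phi> A)"
  shows "bd_delta N \<Phi> f b = A"
  unfolding bd_delta_def circle_derivation_eqI[OF assms(2) Phi_carrier[OF assms(1)]]
  by (rule Phi_inv[OF assms(1)])

section \<open>Derivations determined by their values on the generators\<close>

lemma is_circle_deriv_derivation:
  assumes D: "bd_derivation N D"
    and DP: "\<And>s r. s < N \<Longrightarrow> r < N \<Longrightarrow> D (P_op N s r) = 0"
    and DW: "\<And>t. \<Phi> (D (shift_op (int N))) t = (f t * cis t) \<cdot>\<^sub>m 1\<^sub>m N"
    and b: "b \<in> bd_poly N"
  shows "is_circle_deriv N f (\<Phi> b) (\<Phi> (D b))"
proof -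
  have Dm: "D a \<in> bd_alg N" if "a \<in> bd_poly N" for a
    using D that unfolding bd_derivation_def by blast
  have Dadd: "D (a + b) = D a + D b" and Dmult: "D (a o\<^sub>L b) = (D a o\<^sub>L b) + (a o\<^sub>L D b)"
    if "a \<in> bd_poly N" "b \<in> bd_poly N" for a b
    using D that unfolding bd_derivation_def by blast+
  have Dscale: "D (cscale_op c a) = cscale_op c (D a)" if "a \<in> bd_poly N" for a c
    using D that unfolding bd_derivation_def by blast
  note sm = shift_op_in_bd_poly
  show ?thesis
    using b unfolding bd_poly_eq_unit_alg[OF N]
  proof (induction rule: unit_alg.induct)
    case (P s r)
    show ?case
      by (rule is_circle_derivI[where F' = "\<lambda>i j t. 0"]) (simp_all add: Phi_P P DP Phi_0)
  next
    case shift
    show ?case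
      using is_circle_deriv_cis[of N f 1] unfolding Phi_shift DW[abs_def] by simp
  next
    case shift_inv
    let ?W = "shift_op (int N)" and ?W' = "shift_op (- int N)"
    note DW' = Dm[OF sm, of "- int N"]
    have units: "id_blinfun = (\<Sum>s<N. P_op N s s)" using P_sum[OF N] by simp
    \<comment> \<open>\<open>D\<close> of the identity must be 0. The identity is the sum of the
      diagonal units, each annihilated by \<open>D\<close>; arbitrary index sets make the finite
      induction possible.\<close>
    have "D (\<Sum>s\<in>S. P_op N s s) = 0" if "S \<subseteq> {..<N}" for S
      using finite_subset[OF that finite_lessThan] that
    proof (induction S rule: finite_induct)
      case empty
      show ?case using Dscale[OF P_op_in_bd_poly, of 0 0 0] by (simp add: cscale_op_0)
    next
      case (insert s S)
      then show ?case
        by (simp add: Dadd star_sum[OF star_subalgebra_bd_poly P_op_in_bd_poly] P_op_in_bd_poly DP)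
    qed
    then have "D (?W' o\<^sub>L ?W) = 0" by (simp add: shift_op_add shift_op_0 units)
    then have "(D ?W' o\<^sub>L ?W) + (?W' o\<^sub>L D ?W) = 0" by (simp add: Dmult sm)
    \<comment> \<open>Multiplying by V^(-N) on the right isolates D(V^(-N)) as -V^(-N) D(V^N)
      V^(-N).\<close>
    then have "((D ?W' o\<^sub>L ?W) + (?W' o\<^sub>L D ?W)) o\<^sub>L ?W' = 0" by simp
    then have "(D ?W' o\<^sub>L (?W o\<^sub>L ?W')) + ((?W' o\<^sub>L D ?W) o\<^sub>L ?W') = 0"
      by (simp only: comp_add_left comp_assoc_op)
    then have "D ?W' = - ((?W' o\<^sub>L D ?W) o\<^sub>L ?W')"
      by (simp add: shift_op_add shift_op_0 add_eq_0_iff2)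
    then have "\<Phi> (D ?W') = \<Phi> (cscale_op (- 1) ((?W' o\<^sub>L D ?W) o\<^sub>L ?W'))"
      by (simp only: cscale_op_minus_1)
    \<comment> \<open>One factor e^(-it) cancels the e^(it) in the image of D(V^N). The result is
      written with the constant -1 to match \<open>is_circle_deriv_cis\<close> for \<open>a\<close>
      = -1.\<close>
    also have "\<dots> = (\<lambda>t. (f t * complex_of_real (- 1) * cis (- 1 * t)) \<cdot>\<^sub>m 1\<^sub>m N)"
      unfolding Phi_ops(2)[OF bd_alg_closed(2)[OF N bd_alg_closed(2)[OF N shift_mem Dm[OF sm]] shift_mem]]
        Phi_ops(3)[OF bd_alg_closed(2)[OF N shift_mem Dm[OF sm]] shift_mem]
        Phi_ops(3)[OF shift_mem Dm[OF sm]] Phi_shift_inv DW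
      by (auto simp: fun_eq_iff cis_mult mult_smult_distrib mult_smult_assoc_mat intro!: eq_matI)
    finally show ?case
      using is_circle_deriv_cis[of N f "-1"] unfolding Phi_shift_inv by simp
  next
    case (add A B)
    then have AB: "A \<in> bd_poly N" "B \<in> bd_poly N" by (simp_all add: bd_poly_eq_unit_alg[OF N])
    show ?case
      unfolding Dadd[OF AB] Phi_ops(1)[OF mem[OF AB(1)] mem[OF AB(2)]] Phi_ops(1)[OF Dm[OF AB(1)] Dm[OF AB(2)]]
      by (intro is_circle_deriv_add add.IH Phi_carrier mem Dm AB)
  next
    case (scale A c)
    then have A: "A \<in> bd_poly N" by (simp add: bd_poly_eq_unit_alg[OF N])
    show ?case
      unfolding Dscale[OF A] Phi_ops(2)[OF mem[OF A]] Phi_ops(2)[OF Dm[OF A]]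
      by (intro is_circle_deriv_scale scale.IH Phi_carrier mem Dm A)
  next
    case (mult A B)
    then have AB: "A \<in> bd_poly N" "B \<in> bd_poly N" by (simp_all add: bd_poly_eq_unit_alg[OF N])
    note m = mem[OF AB(1)] mem[OF AB(2)] Dm[OF AB(1)] Dm[OF AB(2)]
    show ?case
      unfolding Dmult[OF AB] Phi_ops(3)[OF m(1,2)] 
        Phi_ops(1)[OF bd_alg_closed(2)[OF N m(3,2)] bd_alg_closed(2)[OF N m(1,4)]]
        Phi_ops(3)[OF m(3,2)] Phi_ops(3)[OF m(1,4)]
      by (intro is_circle_deriv_mult mult.IH Phi_carrier m)
  qed
qed

section \<open>Uniqueness and existence of the coefficient function\<close>

text \<open>The formula for \<open>f\<close> involves only \<open>D\<close> and not the inner part: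
  V^N is central, so \<open>E\<close> kills it. Since (1/i) d/dt fixes e^(it), a factor e^(-it)
  recovers \<open>f\<close>.\<close>

lemma decomposition_coefficient:
  assumes f: "f \<in> C_circle" and inner: "bd_inner_derivation N E"
    and eq: "\<forall>b\<in>bd_poly N. D b = bd_delta N \<Phi> f b + E b"
  shows "f t = \<Phi> (D (shift_op (int N))) t $$ (0, 0) * cis (- t)"
proof -
  let ?W = "shift_op (int N)"
  obtain z where z: "z \<in> bd_alg N" "E ?W = (z o\<^sub>L ?W) - (?W o\<^sub>L z)"
    using inner shift_op_in_bd_poly unfolding bd_inner_derivation_def by blast
  then have "D ?W = bd_delta N \<Phi> f ?W"
    using eq shift_op_in_bd_poly by (simp add: shift_central)
  moreover have "circle_derivation N f (\<Phi> ?W) = (\<lambda>t. (f t * cis t) \<cdot>\<^sub>m 1\<^sub>m N)"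
    using is_circle_deriv_cis[of N f 1] unfolding Phi_shift by (intro circle_derivation_eqI) simp_all
  \<comment> \<open>Continuity and periodicity put the function in the range of
    \<open>\<Phi>\<close>, so applying \<open>\<Phi>\<close> undoes the inverse in
    \<open>bd_delta\<close>.\<close>
  moreover have "(\<lambda>t. (f t * cis t) \<cdot>\<^sub>m 1\<^sub>m N) \<in> C_circle_mat N"
    using C_circle_mult[OF f C_circle_cis[of 1 1]] by (intro C_mat_diag(1)[OF _ N]) simp
  ultimately have "\<Phi> (D ?W) t = (f t * cis t) \<cdot>\<^sub>m 1\<^sub>m N"
    by (simp add: bd_delta_def Phi_surj)
  then show ?thesis using N by (simp add: mult.assoc cis_mult)
qed

lemma decomposition_exists:
  assumes D: "bd_derivation N D"
  shows "\<exists>f E. f \<in> C_circle \<and> bd_inner_derivation N E \<and> (\<forall>b\<in>bd_poly N. D b = bd_delta N \<Phi> f b + E b)"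
proof -
  let ?W = "shift_op (int N)"
  obtain z where z: "z \<in> bd_alg N"
    and zP: "\<And>j k. j < N \<Longrightarrow> k < N \<Longrightarrow> D (P_op N j k) = (z o\<^sub>L P_op N j k) - (P_op N j k o\<^sub>L z)"
    using derivation_inner_on_units[OF N D] by blast
  define E where "E = (\<lambda>b. (z o\<^sub>L b) - (b o\<^sub>L z))"
  define D' where "D' = (\<lambda>b. D b - E b)"
  \<comment> \<open>The choice is forced: the operator f (1/i) d/dt sends e^(it) to f e^(it), which
    must be the scalar in the image of D'(V^N).\<close>
  define f where "f t = \<Phi> (D' ?W) t $$ (0, 0) * cis (- t)" for t
  have E: "bd_derivation N E" unfolding E_def by (rule bd_derivation_commutator[OF N z])
  then have inner: "bd_inner_derivation N E" unfolding bd_inner_derivation_def using z by (auto simp: E_def)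
  have D': "bd_derivation N D'" unfolding D'_def by (rule bd_derivation_diff[OF N D E])
  then have D'm: "D' b \<in> bd_alg N" if "b \<in> bd_poly N" for b
    using that unfolding bd_derivation_def by blast
  note D'W = D'm[OF shift_op_in_bd_poly, of "int N"]
  have D'P: "D' (P_op N s r) = 0" if "s < N" "r < N" for s r
    using zP[OF that] by (simp add: D'_def E_def)
  have "D' ?W o\<^sub>L P_op N s r = P_op N s r o\<^sub>L D' ?W" if sr: "s < N" "r < N" for s r
  proof -
    have mult: "D' (a o\<^sub>L b) = (D' a o\<^sub>L b) + (a o\<^sub>L D' b)" if "a \<in> bd_poly N" "b \<in> bd_poly N" for a b
      using D' that unfolding bd_derivation_def by blast
    \<comment> \<open>Applying the Leibniz rule to both sides, with \<open>D'\<close> zero on matrix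
      units, leaves exactly the commutation of D'(V^N) with P_sr.\<close>
    have "D' (?W o\<^sub>L P_op N s r) = D' (P_op N s r o\<^sub>L ?W)"
      by (simp only: shift_central[OF P_mem])
    then show ?thesis by (simp add: mult shift_op_in_bd_poly P_op_in_bd_poly D'P sr)
  qed
  note scalar = Phi_commutant[OF D'W this]
  have "f t * cis t = \<Phi> (D' ?W) t $$ (0, 0)" for t
    by (simp add: f_def mult.assoc cis_mult)
  with scalar have "\<Phi> (D' ?W) t = (f t * cis t) \<cdot>\<^sub>m 1\<^sub>m N" for t
    by (simp only:)
  then have deriv: "is_circle_deriv N f (\<Phi> b) (\<Phi> (D' b))" if "b \<in> bd_poly N" for b
    using is_circle_deriv_derivation[OF D' _ _ that] D'P by blast
  have "f \<in> C_circle"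
    unfolding f_def using C_circle_mult[OF C_matD(1)[OF Phi_mem[OF D'W] N N] C_circle_cis[of 1 "-1"]] by simp
  moreover have "D b = bd_delta N \<Phi> f b + E b" if "b \<in> bd_poly N" for b
    using bd_delta_eqI[OF D'm[OF that] deriv[OF that]] by (simp add: D'_def)
  ultimately show ?thesis using inner by blast
qed

end

theorem theorem4p6:
  fixes N :: nat
    and \<delta> :: "ell2_op \<Rightarrow> ell2_op"
    and \<Phi> :: "ell2_op \<Rightarrow> real \<Rightarrow> complex mat"
  assumes "N > 0"
    and "bd_derivation N \<delta>"
    and "bd_identification N \<Phi>"
  shows "\<exists>!f. f \<in> C_circle \<and>
           (\<exists>\<delta>'. bd_inner_derivation N \<delta>' \<and>
              (\<forall>b\<in>bd_poly N. \<delta> b = bd_delta N \<Phi> f b + \<delta>' b))"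
proof -
  interpret bunce_deddens N \<Phi> using assms(1,3) by unfold_locales
  show ?thesis
  proof (rule ex_ex1I)
    show "\<exists>f. f \<in> C_circle \<and> (\<exists>\<delta>'. bd_inner_derivation N \<delta>' \<and>
        (\<forall>b\<in>bd_poly N. \<delta> b = bd_delta N \<Phi> f b + \<delta>' b))"
      using decomposition_exists[OF assms(2)] by blast
    fix f g
    assume "f \<in> C_circle \<and> (\<exists>\<delta>'. bd_inner_derivation N \<delta>' \<and> (\<forall>b\<in>bd_poly N. \<delta> b = bd_delta N \<Phi> f b + \<delta>' b))"
      and "g \<in> C_circle \<and> (\<exists>\<delta>'. bd_inner_derivation N \<delta>' \<and> (\<forall>b\<in>bd_poly N. \<delta> b = bd_delta N \<Phi> g b + \<delta>' b))"
    \<comment> \<open>Both functions satisfy the same pointwise formula in terms of the image of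
      \<delta>(V^N), whatever the two inner parts are.\<close>
    then show "f = g" using decomposition_coefficient[of _ _ \<delta>] by (metis ext)
  qed
qed

end
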